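(* Let $r\in\mathbb{N}$ ($r\ge 1$), $1\le s<\infty$, $1\le p\le\infty$, $2\le q\le\infty$, and $\mu>2r-\frac1s-\frac2q+\frac32$ (with $1/p=0$ if $p=\infty$ and $2/q=0$ if $q=\infty$). For any constants $C_1,C_2>0$ there is a constant $c>0$, independent of $f$, $f^\delta$, $\delta$ and $N$, such that the following holds. Let $0<\delta<1$, let $f\in W_s^\mu$ with $\|f\|_{s,\mu}\le 1$, let $(\langle f^\delta,\varphi_k\rangle)_{k\ge0}$ be a sequence of real numbers such that $\xi_k=\langle f,\varphi_k\rangle-\langle f^\delta,\varphi_k\rangle$ satisfies $\|(\xi_k)_{k\ge 0}\|_{\ell_p}\le\delta$, and let $N\ge r$ be an integer with $N\asymp\delta^{-\frac{1}{\mu-1/p+1/s}}$, i.e. $C_1\delta^{-\frac{1}{\mu-1/p+1/s}}\le N\le C_2\delta^{-\frac{1}{\mu-1/p+1/s}}$. Then $$\|f^{(r)}-\mathcal{D}_N^{(r)}f^\delta\|_{q}\le c\,\delta^{\frac{\mu-2r+1/s+2/q-3/2}{\mu-1/p+1/s}}.$$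
   Context: $L_q$, $2\le q\le\infty$, is the usual space of real-valued functions on $[-1,1]$ with Lebesgue measure and norm $\|\cdot\|_q$. The orthonormal Legendre polynomials on $[-1,1]$ are $\varphi_k(t)=\sqrt{k+1/2}\,(2^kk!)^{-1}\frac{d^k}{dt^k}[(t^2-1)^k]$, $k=0,1,2,\dots$. For $f\in L_2$, $\langle f,\varphi_k\rangle=\int_{-1}^1 f(t)\varphi_k(t)\,dt$. For $\mu>0$, $1\le s<\infty$, the weighted Wiener class is $W_s^\mu=\{f\in L_2:\ \|f\|_{s,\mu}^s:=\sum_{k=0}^\infty(\max\{1,k\})^{s\mu}|\langle f,\varphi_k\rangle|^s<\infty\}$. For $f\in W_s^\mu$, the derivative of order $r$ is represented as (and understood through) the series $f^{(r)}=\sum_{k=r}^\infty\langle f,\varphi_k\rangle\varphi_k^{(r)}$, with convergence in the metric in which the error is measured. $\ell_p$ is the usual space of real sequences with norm $\|x\|_{\ell_p}=(\sum_k|x_k|^p)^{1/p}$ for $p<\infty$ and $\sup_k|x_k|$ for $p=\infty$. The perturbed data $f^\delta$ are given only through a sequence of real numbers denoted $\langle f^\delta,\varphi_k\rangle$, $k\ge0$ (perturbed Fourier-Legendre coefficients). The truncation method is $\mathcal{D}_N^{(r)}f^\delta(t)=\sum_{k=r}^N\langle f^\delta,\varphi_k\rangle\varphi_k^{(r)}(t)$. *)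

theory Defs
  imports
    "HOL-Probability.Essential_Supremum"
    "HOL-Computational_Algebra.Polynomial"
begin

(* Exponents that may be infinite have type ennreal; enn2real (1 / p) is then the real number 1/p,
   which is 0 for p = \<infinity>. *)

abbreviation leb :: "real measure" where
  "leb \<equiv> lebesgue_on {-1..1}"

definition Lq_space :: "ennreal \<Rightarrow> (real \<Rightarrow> real) set" where
  "Lq_space q = {f \<in> borel_measurable leb.
     if q = \<infinity> then esssup leb (\<lambda>t. ereal \<bar>f t\<bar>) < \<infinity>
     else integrable leb (\<lambda>t. \<bar>f t\<bar> powr enn2real q)}"

(* Meaningful for members of Lq_space q only. *)
definition Lq_norm :: "ennreal \<Rightarrow> (real \<Rightarrow> real) \<Rightarrow> real" where
  "Lq_norm q f =
     (if q = \<infinity> then real_of_ereal (esssup leb (\<lambda>t. ereal \<bar>f t\<bar>))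
      else (\<integral>t. \<bar>f t\<bar> powr enn2real q \<partial>leb) powr (1 / enn2real q))"

definition lp_space :: "ennreal \<Rightarrow> (nat \<Rightarrow> real) set" where
  "lp_space p = {x.
     if p = \<infinity> then bdd_above (range (\<lambda>k. \<bar>x k\<bar>))
     else summable (\<lambda>k. \<bar>x k\<bar> powr enn2real p)}"

(* Meaningful for members of lp_space p only. *)
definition lp_norm :: "ennreal \<Rightarrow> (nat \<Rightarrow> real) \<Rightarrow> real" where
  "lp_norm p x =
     (if p = \<infinity> then (SUP k. \<bar>x k\<bar>)
      else (\<Sum>k. \<bar>x k\<bar> powr enn2real p) powr (1 / enn2real p))"

definition legendre :: "nat \<Rightarrow> real poly" where
  "legendre k = smult (sqrt (real k + 1/2) / (2 ^ k * fact k))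
     ((pderiv ^^ k) ([:-1, 0, 1:] ^ k))"

definition legendre_deriv :: "nat \<Rightarrow> nat \<Rightarrow> real \<Rightarrow> real" where
  "legendre_deriv r k t = poly ((pderiv ^^ r) (legendre k)) t"

definition legendre_coeff :: "(real \<Rightarrow> real) \<Rightarrow> nat \<Rightarrow> real" where
  "legendre_coeff f k = (\<integral>t. f t * poly (legendre k) t \<partial>leb)"

definition wiener_class :: "real \<Rightarrow> real \<Rightarrow> (real \<Rightarrow> real) set" where
  "wiener_class s \<mu> = {f \<in> Lq_space 2.
     summable (\<lambda>k. real (max 1 k) powr (s * \<mu>) * \<bar>legendre_coeff f k\<bar> powr s)}"

(* Meaningful for members of wiener_class s \<mu> only. *)
definition wiener_norm :: "real \<Rightarrow> real \<Rightarrow> (real \<Rightarrow> real) \<Rightarrow> real" where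
  "wiener_norm s \<mu> f =
     (\<Sum>k. real (max 1 k) powr (s * \<mu>) * \<bar>legendre_coeff f k\<bar> powr s) powr (1 / s)"

(* truncated_deriv r N a is the truncation method applied to data with coefficients a. *)
definition truncated_deriv :: "nat \<Rightarrow> nat \<Rightarrow> (nat \<Rightarrow> real) \<Rightarrow> real \<Rightarrow> real" where
  "truncated_deriv r N a t = (\<Sum>k=r..N. a k * legendre_deriv r k t)"

(* g is the sum, in the metric of L_q, of the series that defines the r-th derivative of f;
   g is determined only up to null sets. *)
definition is_series_deriv :: "ennreal \<Rightarrow> nat \<Rightarrow> (real \<Rightarrow> real) \<Rightarrow> (real \<Rightarrow> real) \<Rightarrow> bool" where
  "is_series_deriv q r f g \<longleftrightarrow> g \<in> Lq_space q \<and>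
     (\<lambda>n. Lq_norm q (\<lambda>t. g t - truncated_deriv r n (legendre_coeff f) t)) \<longlonglongrightarrow> 0"

end

theory Submission
  imports Defs
begin

text \<open>
  The error is estimated by the triangle inequality in \<open>L_q\<close>, applied term by term to

    \<open>(\<Sum>k=r..N. \<xi>\<^sub>k \<phi>\<^sub>k\<^bsup>(r)\<^esup>) + (\<Sum>k>N. a\<^sub>k \<phi>\<^sub>k\<^bsup>(r)\<^esup>)\<close>,

  where \<open>a\<^sub>k\<close> are the coefficients of \<open>f\<close> and \<open>\<xi>\<^sub>k\<close> the errors in the data. No cancellation between
  different degrees has to be used, because the single terms already have the size that the claimed
  rate asks for: the norm of \<open>\<phi>\<^sub>k\<^bsup>(r)\<^esup>\<close> in \<open>L_q\<close> is at most \<open>4 k\<^bsup>e\<^esup>\<close> with \<open>e = 2r + 1/2 - 2/q\<close>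
  (lemma \<open>Lq_bounded_legendre_deriv\<close>). For \<open>q = \<infinity>\<close> the exponent is \<open>2r + 1/2\<close> and for \<open>q = 2\<close> it
  is \<open>2r - 1/2\<close>; the exponents in between follow from
  \<open>\<bar>y\<bar>\<^bsup>q\<^esup> \<le> (sup \<bar>y\<bar>)\<^bsup>q-2\<^esup> y\<^sup>2\<close>.

  Both extreme cases come from one auxiliary function. The derivative \<open>y\<close> of order \<open>r\<close> satisfies
  \<open>(1 - t\<^sup>2) y'' - 2 (r + 1) t y' + \<lambda> y = 0\<close> with \<open>\<lambda> = (k + r + 1) (k - r)\<close>. Therefore
  \<open>F = y\<^sup>2 + (1 - t\<^sup>2) y'\<^sup>2 / \<lambda>\<close> has the derivative \<open>2 (2r + 1) t y'\<^sup>2 / \<lambda>\<close>, which has the sign of \<open>t\<close>.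
  So \<open>F\<close>, which dominates \<open>y\<^sup>2\<close>, is largest at an end point; there the differential equation loses
  its leading term and gives the values of the derivatives by recursion on \<open>r\<close>. Integrating the
  derivative of \<open>t F\<close> bounds the integral of \<open>y'\<^sup>2\<close>, which is the \<open>L_2\<close> estimate for the
  derivative of the next order.

  With this growth, the noise contributes at most
  \<open>4 N\<^bsup>e\<^esup> (\<Sum>k=r..N. \<bar>\<xi>\<^sub>k\<bar>) \<le> 4 N\<^bsup>e+1-1/p\<^esup> \<delta>\<close>, by the power mean inequality. The tail is cut
  into blocks \<open>2\<^sup>j N < k \<le> 2\<^bsup>j+1\<^esup> N\<close>; on each of them the power mean inequality and the bound on the
  Wiener norm give a multiple of \<open>(2\<^sup>j N)\<^bsup>-\<rho>\<^esup>\<close> with \<open>\<rho> = \<mu> - e - 1 + 1/s\<close>, and these sum up to a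
  multiple of \<open>N\<^bsup>-\<rho>\<^esup>\<close>. The hypothesis on \<open>\<mu>\<close> says exactly that \<open>\<rho> > 0\<close>. Since
  \<open>\<mu> - 1/p + 1/s = \<rho> + (e + 1 - 1/p)\<close>, the prescribed order of \<open>N\<close> balances the two contributions.
  The same tail estimate makes the series of the derivative absolutely convergent in \<open>L_q\<close>, so that
  its sum exists.
\<close>

section \<open>Size of the derivatives of the Legendre polynomials\<close>

text \<open>
  At the root, only those terms of the product rule survive in which every derivative falls on the
  power.
\<close>
lemma poly_higher_pderiv_root_power:
  fixes p :: "real poly"
  shows "poly ((pderiv ^^ k) ([:-a, 1:] ^ k * p)) a = fact k * poly p a"
proof (induction k arbitrary: p)
  case 0
  then show ?case by simp
next
  case (Suc k)
  have "pderiv ([:-a, 1:] ^ Suc k * p)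
      = [:-a, 1:] ^ k * (smult (real (Suc k)) p + [:-a, 1:] * pderiv p)"
  proof -
    have "pderiv ([:-a, 1:] ^ Suc k) = smult (real (Suc k)) ([:-a, 1:] ^ k)"
      by (simp only: pderiv_power_Suc) (simp add: pderiv_pCons)
    then show ?thesis
      by (simp only: pderiv_mult power_Suc) (simp add: algebra_simps)
  qed
  then have "poly ((pderiv ^^ Suc k) ([:-a, 1:] ^ Suc k * p)) a
      = fact k * poly (smult (real (Suc k)) p + [:-a, 1:] * pderiv p) a"
    by (simp only: funpow_Suc_right comp_apply Suc.IH)
  also have "\<dots> = fact (Suc k) * poly p a"
    by simp
  finally show ?case .
qed

text \<open>
  Since \<open>a\<close> is \<open>1\<close> or \<open>-1\<close>, the polynomial \<open>t\<^sup>2 - 1\<close> factors as \<open>(t - a) (t + a)\<close>, and the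
  cofactor \<open>(t + a)\<^sup>k\<close> has the value \<open>(2 a)\<^sup>k\<close> at \<open>a\<close>.
\<close>
lemma abs_legendre_endpoint:
  assumes "\<bar>a\<bar> = 1"
  shows "\<bar>poly (legendre k) a\<bar> = sqrt (real k + 1/2)"
proof -
  have aa: "a * a = 1" using assms by (metis abs_mult_self_eq mult_1)
  have "[:-1, 0, 1::real:] = [:-a, 1:] * [:a, 1:]" using aa by simp
  then have "[:-1, 0, 1::real:] ^ k = [:-a, 1:] ^ k * [:a, 1:] ^ k"
    by (simp only: power_mult_distrib)
  then have "poly ((pderiv ^^ k) ([:-1, 0, 1:] ^ k)) a = fact k * (2 * a) ^ k"
    by (simp only: poly_higher_pderiv_root_power) (simp add: poly_power)
  then have "\<bar>poly (legendre k) a\<bar>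
      = \<bar>sqrt (real k + 1/2)\<bar> / (2 ^ k * fact k) * (fact k * (2 * \<bar>a\<bar>) ^ k)"
    by (simp add: legendre_def abs_mult power_abs)
  then show ?thesis using assms by simp
qed

text \<open>
  The power \<open>v = (t\<^sup>2 - 1)\<^sup>k\<close> solves \<open>(t\<^sup>2 - 1) v' = 2 k t v\<close>; this is its derivative of order
  \<open>n + 1\<close>.
\<close>
lemma higher_pderiv_rodrigues_ode:
  fixes k :: nat
  defines "u \<equiv> \<lambda>n. (pderiv ^^ n) ([:-1, 0, 1::real:] ^ k)"
  shows "[:-1, 0, 1:] * u (n + 2) + [:0, 2 * (real n + 1) - 2 * real k:] * u (n + 1)
      + smult ((real n + 1) * (real n - 2 * real k)) (u n) = 0"
proof (induction n)
  case 0
  have uS: "u (Suc m) = pderiv (u m)" for m by (simp add: u_def)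
  have first: "[:-1, 0, 1:] * u 1 = [:0, 2 * real k:] * u 0"
  proof (cases k)
    case 0
    then show ?thesis by (simp add: u_def)
  next
    case (Suc j)
    have "u 1 = smult (real k) ([:-1, 0, 1:] ^ j) * [:0, 2:]"
      by (simp only: u_def Suc funpow.simps comp_apply One_nat_def id_apply pderiv_power_Suc)
        (simp add: pderiv_pCons)
    then show ?thesis
      by (intro poly_eq_poly_eq_iff[THEN iffD1] ext) (simp add: u_def Suc algebra_simps)
  qed
  have "pderiv ([:-1, 0, 1:] * u 1) = pderiv ([:0, 2 * real k:] * u 0)"
    by (simp only: first)
  then have *: "[:-1, 0, 1:] * u 2 + [:0, 2:] * u 1 = [:0, 2 * real k:] * u 1 + smult (2 * real k) (u 0)"
    by (simp only: pderiv_mult uS numeral_2_eq_2 One_nat_def) (simp add: pderiv_pCons algebra_simps)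
  show ?case
  proof (rule poly_eq_poly_eq_iff[THEN iffD1], rule ext)
    fix x
    from * have "poly ([:-1, 0, 1:] * u 2 + [:0, 2:] * u 1) x
        = poly ([:0, 2 * real k:] * u 1 + smult (2 * real k) (u 0)) x"
      by simp
    then show "poly ([:-1, 0, 1:] * u (0 + 2) + [:0, 2 * (real 0 + 1) - 2 * real k:] * u (0 + 1)
      + smult ((real 0 + 1) * (real 0 - 2 * real k)) (u 0)) x = poly 0 x"
      by (simp add: algebra_simps numeral_2_eq_2)
  qed
next
  case (Suc n)
  have uS: "pderiv (u m) = u (Suc m)" for m by (simp add: u_def)
  have "pderiv ([:-1, 0, 1:] * u (n + 2) + [:0, 2 * (real n + 1) - 2 * real k:] * u (n + 1)
      + smult ((real n + 1) * (real n - 2 * real k)) (u n)) = 0"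
    by (simp only: Suc pderiv_0)
  then have *: "[:-1, 0, 1:] * u (n + 3) + [:0, 2:] * u (n + 2)
      + [:0, 2 * (real n + 1) - 2 * real k:] * u (n + 2)
      + smult (2 * (real n + 1) - 2 * real k) (u (n + 1))
      + smult ((real n + 1) * (real n - 2 * real k)) (u (n + 1)) = 0"
    by (simp only: pderiv_mult pderiv_add pderiv_smult uS)
      (simp add: pderiv_pCons algebra_simps numeral_3_eq_3 numeral_2_eq_2)
  show ?case
  proof (rule poly_eq_poly_eq_iff[THEN iffD1], rule ext)
    fix x
    have eqs: "Suc n + 2 = n + 3" "Suc n + 1 = n + 2" "Suc n = n + 1" by simp_all
    from arg_cong[OF *, of "\<lambda>p. poly p x"]
    show "poly ([:-1, 0, 1:] * u (Suc n + 2) + [:0, 2 * (real (Suc n) + 1) - 2 * real k:] * u (Suc n + 1)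
      + smult ((real (Suc n) + 1) * (real (Suc n) - 2 * real k)) (u (Suc n))) x = poly 0 x"
      unfolding eqs by (simp add: algebra_simps numeral_2_eq_2 numeral_3_eq_3)
  qed
qed

text \<open>
  By Rodrigues' formula, the derivative of order \<open>r\<close> of the Legendre polynomial is, up to a factor,
  the derivative of order \<open>r + k\<close> of \<open>(t\<^sup>2 - 1)\<^sup>k\<close>.
\<close>
lemma legendre_deriv_ode:
  "(1 - t\<^sup>2) * legendre_deriv (r + 2) k t
    = 2 * (real r + 1) * t * legendre_deriv (r + 1) k t
      - (real k + real r + 1) * (real k - real r) * legendre_deriv r k t"
proof -
  define u where "u n = poly ((pderiv ^^ n) ([:-1, 0, 1::real:] ^ k)) t" for n
  define c where "c = sqrt (real k + 1/2) / (2 ^ k * fact k)"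
  have D: "legendre_deriv m k t = c * u (m + k)" for m
    by (simp add: legendre_deriv_def legendre_def u_def c_def higher_pderiv_smult funpow_add)
  have "(t\<^sup>2 - 1) * u (r + k + 2) + (2 * (real (r + k) + 1) - 2 * real k) * t * u (r + k + 1)
      + (real (r + k) + 1) * (real (r + k) - 2 * real k) * u (r + k) = 0"
    using arg_cong[OF higher_pderiv_rodrigues_ode[where k = k and n = "r + k"], of "\<lambda>p. poly p t"]
    unfolding u_def by (simp add: algebra_simps power2_eq_square)
  then have "c * ((t\<^sup>2 - 1) * u (r + k + 2) + (2 * (real (r + k) + 1) - 2 * real k) * t * u (r + k + 1)
      + (real (r + k) + 1) * (real (r + k) - 2 * real k) * u (r + k)) = 0"
    by simp
  then show ?thesis
    unfolding D by (simp add: algebra_simps)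
qed

lemma has_real_derivative_legendre_deriv [derivative_intros]:
  "(f has_real_derivative f') (at x) \<Longrightarrow>
   ((\<lambda>x. legendre_deriv r k (f x)) has_real_derivative legendre_deriv (Suc r) k (f x) * f') (at x)"
  unfolding legendre_deriv_def
  by (rule DERIV_chain2[where f = "poly ((pderiv ^^ r) (legendre k))"])
    (use poly_DERIV[of "(pderiv ^^ r) (legendre k)"] in simp_all)

lemma continuous_on_legendre_deriv [continuous_intros]:
  "continuous_on A (legendre_deriv r k)"
  unfolding legendre_deriv_def by (intro continuous_intros)

lemma legendre_deriv_eq_0:
  assumes "r > k"
  shows "legendre_deriv r k t = 0"
proof -
  have "degree (legendre k) \<le> k"
    by (simp add: legendre_def degree_higher_pderiv degree_power_eq)
  then have "(pderiv ^^ r) (legendre k) = 0"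
    using assms by (intro poly_eqI) (simp add: coeff_higher_pderiv coeff_eq_0)
  then show ?thesis by (simp add: legendre_deriv_def)
qed

lemma eigenvalue_le: "(real k + real r + 1) * (real k - real r) \<le> 2 * (real k)\<^sup>2"
proof -
  have "(real k + real r + 1) * (real k - real r) = (real k)\<^sup>2 + real k - ((real r)\<^sup>2 + real r)"
    by (simp add: algebra_simps power2_eq_square)
  moreover have "real k \<le> (real k)\<^sup>2"
    by (simp add: power2_eq_square flip: of_nat_mult)
  moreover have "0 \<le> (real r)\<^sup>2 + real r" by simp
  ultimately show ?thesis by linarith
qed

text \<open>
  At an end point the term with the second derivative drops out of the differential equation, which
  then expresses the derivative of order \<open>r + 1\<close> by the one of order \<open>r\<close>.
\<close>
lemma abs_legendre_deriv_endpoint: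
  assumes "k \<ge> 1" "\<bar>a\<bar> = 1"
  shows "\<bar>legendre_deriv r k a\<bar> \<le> real k ^ (2 * r) * sqrt (real k + 1/2)"
proof (induction r)
  case 0
  then show ?case using abs_legendre_endpoint[OF assms(2)] by (simp add: legendre_deriv_def)
next
  case (Suc r)
  show ?case
  proof (cases "Suc r > k")
    case True
    then show ?thesis by (simp add: legendre_deriv_eq_0)
  next
    case False
    have "1 - a\<^sup>2 = 0" using assms(2) by (simp add: power2_eq_1_iff abs_eq_iff')
    with legendre_deriv_ode[of a r k]
    have "2 * (real r + 1) * a * legendre_deriv (r + 1) k a
      = (real k + real r + 1) * (real k - real r) * legendre_deriv r k a"
      by simp
    then have "\<bar>2 * (real r + 1) * a * legendre_deriv (r + 1) k a\<bar>
      = \<bar>(real k + real r + 1) * (real k - real r) * legendre_deriv r k a\<bar>"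
      by simp
    then have *: "2 * (real r + 1) * \<bar>legendre_deriv (r + 1) k a\<bar>
      = (real k + real r + 1) * (real k - real r) * \<bar>legendre_deriv r k a\<bar>"
      using False assms(2) by (simp add: abs_mult)
    have "2 * \<bar>legendre_deriv (r + 1) k a\<bar> \<le> 2 * (real r + 1) * \<bar>legendre_deriv (r + 1) k a\<bar>"
      by (intro mult_right_mono) auto
    also have "\<dots> \<le> 2 * (real k)\<^sup>2 * (real k ^ (2 * r) * sqrt (real k + 1/2))"
      unfolding * by (intro mult_mono eigenvalue_le Suc.IH) auto
    finally show ?thesis by (simp add: power2_eq_square mult_ac)
  qed
qed

text \<open>
  Sonin's function for the differential equation of the derivative of order \<open>r\<close>. Its denominator is
  the coefficient of the undifferentiated term of that equation; it is positive for \<open>r < k\<close>, the only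
  case in which the function is used.
\<close>
definition sonin :: "nat \<Rightarrow> nat \<Rightarrow> real \<Rightarrow> real" where
  "sonin r k t = (legendre_deriv r k t)\<^sup>2
     + (1 - t\<^sup>2) * (legendre_deriv (r + 1) k t)\<^sup>2 / ((real k + real r + 1) * (real k - real r))"

text \<open>
  Replacing \<open>(1 - t\<^sup>2) y''\<close> by means of the differential equation cancels the mixed term \<open>y y'\<close>.
\<close>
lemma has_real_derivative_sonin:
  assumes "r < k"
  shows "(sonin r k has_real_derivative
     2 * (2 * real r + 1) * t * (legendre_deriv (r + 1) k t)\<^sup>2
       / ((real k + real r + 1) * (real k - real r))) (at t)"
proof -
  define l where "l = (real k + real r + 1) * (real k - real r)"
  define y0 y1 y2 where "y0 = legendre_deriv r k t" and "y1 = legendre_deriv (Suc r) k t"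
    and "y2 = legendre_deriv (Suc (Suc r)) k t"
  have l: "l > 0" using assms by (simp add: l_def)
  have ode: "(1 - t\<^sup>2) * y2 = 2 * (real r + 1) * t * y1 - l * y0"
    using legendre_deriv_ode[of t r k] by (simp add: y0_def y1_def y2_def l_def)
  have "(sonin r k has_real_derivative
     2 * y0 * y1 + (2 * y1 * ((1 - t\<^sup>2) * y2) - 2 * t * y1\<^sup>2) / l) (at t)"
    unfolding sonin_def[abs_def] l_def[symmetric]
    using l by (auto intro!: derivative_eq_intros simp: y0_def y1_def y2_def field_simps power2_eq_square)
  also have "2 * y0 * y1 + (2 * y1 * ((1 - t\<^sup>2) * y2) - 2 * t * y1\<^sup>2) / l
      = 2 * (2 * real r + 1) * t * y1\<^sup>2 / l"
    unfolding ode using l by (simp add: field_simps power2_eq_square)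
  finally show ?thesis by (simp add: y1_def l_def)
qed

text \<open>
  The function decreases on \<open>[-1, 0]\<close> and increases on \<open>[0, 1]\<close>, so it is bounded by its values at
  the end points, where it is just the square of the derivative.
\<close>
lemma sonin_le:
  assumes "r < k" "k \<ge> 1" "t \<in> {-1..1}"
  shows "sonin r k t \<le> real k ^ (4 * r) * (real k + 1/2)"
proof -
  have E: "sonin r k a \<le> real k ^ (4 * r) * (real k + 1/2)" if "\<bar>a\<bar> = 1" for a
  proof -
    have "sonin r k a = \<bar>legendre_deriv r k a\<bar>\<^sup>2"
      using that by (simp add: sonin_def power2_eq_1_iff abs_eq_iff')
    also have "\<dots> \<le> (real k ^ (2 * r) * sqrt (real k + 1/2))\<^sup>2"
      using abs_legendre_deriv_endpoint[OF assms(2) that] by (intro power_mono) auto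
    also have "\<dots> = real k ^ (4 * r) * (real k + 1/2)"
      by (simp add: power_mult_distrib flip: power_mult)
    finally show ?thesis .
  qed
  have pos: "(real k + real r + 1) * (real k - real r) > 0" using assms by simp
  define d where "d x = 2 * (2 * real r + 1) * x * (legendre_deriv (r + 1) k x)\<^sup>2
       / ((real k + real r + 1) * (real k - real r))" for x
  have deriv: "(sonin r k has_real_derivative d x) (at x)" for x
    unfolding d_def by (rule has_real_derivative_sonin[OF assms(1)])
  show ?thesis
  proof (cases "t \<ge> 0")
    case True
    have "sonin r k t \<le> sonin r k 1"
    proof (rule DERIV_nonneg_imp_nondecreasing[where f = "sonin r k"])
      fix x assume "t \<le> x" "x \<le> 1"
      with True have "0 \<le> d x" unfolding d_def using pos
        by (intro divide_nonneg_pos mult_nonneg_nonneg) auto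
      with deriv show "\<exists>y. (sonin r k has_real_derivative y) (at x) \<and> 0 \<le> y" by blast
    qed (use assms in auto)
    with E[of 1] show ?thesis by simp
  next
    case False
    have "sonin r k t \<le> sonin r k (-1)"
    proof (rule DERIV_nonpos_imp_nonincreasing[where f = "sonin r k"])
      fix x assume "-1 \<le> x" "x \<le> t"
      with False have "d x \<le> 0" unfolding d_def using pos
        by (intro divide_nonpos_pos mult_nonpos_nonneg mult_nonneg_nonpos) auto
      with deriv show "\<exists>y. (sonin r k has_real_derivative y) (at x) \<and> y \<le> 0" by blast
    qed (use assms in auto)
    with E[of "-1"] show ?thesis by simp
  qed
qed

text \<open>
  For \<open>r < k\<close> Sonin's function dominates the square. The derivatives of order at least \<open>k\<close>, for which
  its denominator is not positive, are constant.
\<close>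
lemma legendre_deriv_square_le:
  assumes "k \<ge> 1" "t \<in> {-1..1}"
  shows "(legendre_deriv r k t)\<^sup>2 \<le> real k ^ (4 * r) * (real k + 1/2)"
proof (cases r k rule: linorder_cases)
  case less
  have "t\<^sup>2 \<le> 1" using assms by (simp add: abs_square_le_1 abs_le_iff)
  then have "(legendre_deriv r k t)\<^sup>2 \<le> sonin r k t"
    using less by (simp add: sonin_def)
  with sonin_le[OF less assms] show ?thesis by simp
next
  case equal
  have "legendre_deriv r k t = legendre_deriv r k 1"
  proof (rule DERIV_isconst_all[of "legendre_deriv r k", rule_format])
    fix x
    show "(legendre_deriv r k has_real_derivative 0) (at x)"
      using has_real_derivative_legendre_deriv[OF DERIV_ident, where r = r and k = k and x = x] equal
      by (simp add: legendre_deriv_eq_0)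
  qed
  then have "(legendre_deriv r k t)\<^sup>2 = \<bar>legendre_deriv r k 1\<bar>\<^sup>2" by simp
  also have "\<dots> \<le> (real k ^ (2 * r) * sqrt (real k + 1/2))\<^sup>2"
    using abs_legendre_deriv_endpoint[OF assms(1)] by (intro power_mono) auto
  also have "\<dots> = real k ^ (4 * r) * (real k + 1/2)"
    by (simp add: power_mult_distrib flip: power_mult)
  finally show ?thesis .
next
  case greater
  then show ?thesis by (simp add: legendre_deriv_eq_0)
qed

lemma legendre_deriv_measurable [measurable]: "legendre_deriv r k \<in> borel_measurable leb"
  by (intro continuous_imp_measurable_on_sets_lebesgue continuous_intros) auto

text \<open>
  Let \<open>F\<close> be Sonin's function for the order \<open>m = r - 1\<close> and \<open>y\<close> the derivative of order \<open>r\<close>. The part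
  \<open>t\<^sup>2 y\<^sup>2\<close> of \<open>y\<^sup>2\<close> is controlled by the derivative \<open>F + t F'\<close> of \<open>t F\<close>, whose integral is a boundary
  term, and the part \<open>(1 - t\<^sup>2) y\<^sup>2\<close> is at most \<open>\<lambda> F\<close> by the definition of \<open>F\<close>.
\<close>
lemma integral_legendre_deriv_square_le:
  assumes "k \<ge> 1" "r \<ge> 1"
  shows "(\<integral>t. (legendre_deriv r k t)\<^sup>2 \<partial>leb) \<le> 6 * real k ^ (4 * r - 2) * (real k + 1/2)"
proof (cases "r > k")
  case True
  then show ?thesis by (simp add: legendre_deriv_eq_0)
next
  case False
  define m where "m = r - 1"
  have r: "r = Suc m" and m: "m < k" using assms False by (auto simp: m_def)
  define l where "l = (real k + real m + 1) * (real k - real m)"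
  define M where "M = real k ^ (4 * m) * (real k + 1/2)"
  define y where "y = legendre_deriv (Suc m) k"
  have l: "l > 0" using m by (simp add: l_def)
  have l2: "l \<le> 2 * (real k)\<^sup>2"
    unfolding l_def by (rule eigenvalue_le)
  have M: "M \<ge> 0" by (simp add: M_def)
  define G' where "G' t = sonin m k t + 2 * (2 * real m + 1) * t\<^sup>2 * (y t)\<^sup>2 / l" for t
  have G: "((\<lambda>t. t * sonin m k t) has_real_derivative G' t) (at t)" for t
    unfolding G'_def
    by (rule derivative_eq_intros has_real_derivative_sonin[OF m] refl)+
      (simp add: y_def l_def power2_eq_square)
  have FTC: "(G' has_integral (sonin m k 1 + sonin m k (-1))) {-1..1}"
    using fundamental_theorem_of_calculus[of "-1" 1 "\<lambda>t. t * sonin m k t" G'] G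
    by (auto simp: has_real_derivative_iff_has_vector_derivative[symmetric]
        intro: has_field_derivative_at_within)
  have contG: "continuous_on {-1..1} G'"
    unfolding G'_def y_def sonin_def by (intro continuous_intros) (use l l_def in auto)
  have intG: "integrable leb G'"
    by (rule continuous_imp_integrable_real[OF contG])
  have IG: "(\<integral>t. G' t \<partial>leb) \<le> 2 * M"
  proof -
    have "(\<integral>t. G' t \<partial>leb) = integral {-1..1} G'"
      by (rule lebesgue_integral_eq_integral[OF intG]) auto
    also have "\<dots> = sonin m k 1 + sonin m k (-1)" using FTC by (rule integral_unique)
    also have "\<dots> \<le> 2 * M"
      using sonin_le[OF m assms(1), of 1] sonin_le[OF m assms(1), of "-1"] by (simp add: M_def)
    finally show ?thesis .
  qed
  \<comment> \<open>The factor \<open>2 (2 m + 1)\<close> in \<open>G'\<close> is at least \<open>2\<close>; replacing it by \<open>2\<close> gives a bound uniform in \<open>m\<close>.\<close>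
  have pw: "(y t)\<^sup>2 \<le> l * (G' t / 2 + M)" if "t \<in> {-1..1}" for t
  proof -
    define S where "S = sonin m k t"
    have t: "t\<^sup>2 \<le> 1" using that by (simp add: abs_square_le_1 abs_le_iff)
    have S: "S \<le> M" using sonin_le[OF m assms(1) that] by (simp add: M_def S_def)
    have S_eq: "S = (legendre_deriv m k t)\<^sup>2 + (1 - t\<^sup>2) * (y t)\<^sup>2 / l"
      by (simp add: S_def sonin_def l_def y_def)
    have "(1 - t\<^sup>2) * (y t)\<^sup>2 / l \<le> S" using S_eq by simp
    then have 1: "(1 - t\<^sup>2) * (y t)\<^sup>2 \<le> l * S" using l by (simp add: field_simps)
    have S0: "0 \<le> S" using t l by (auto simp: S_eq)
    have "l * (G' t - S) = 2 * (2 * real m + 1) * t\<^sup>2 * (y t)\<^sup>2"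
      using l by (simp add: G'_def S_def)
    moreover have "2 * (t\<^sup>2 * (y t)\<^sup>2) \<le> 2 * (2 * real m + 1) * (t\<^sup>2 * (y t)\<^sup>2)"
      by (intro mult_right_mono) auto
    ultimately have 2: "t\<^sup>2 * (y t)\<^sup>2 \<le> l * ((G' t - S) / 2)" by (simp add: algebra_simps)
    have "(y t)\<^sup>2 \<le> l * (G' t / 2 + S / 2)" using 1 2 by (simp add: algebra_simps)
    also have "\<dots> \<le> l * (G' t / 2 + M)" using l S S0 by (intro mult_left_mono) auto
    finally show ?thesis .
  qed
  have "(\<integral>t. (y t)\<^sup>2 \<partial>leb) \<le> (\<integral>t. l * (G' t / 2 + M) \<partial>leb)"
  proof (rule integral_mono)
    show "integrable leb (\<lambda>t. (y t)\<^sup>2)"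
      unfolding y_def by (intro continuous_imp_integrable_real continuous_intros)
    show "integrable leb (\<lambda>t. l * (G' t / 2 + M))"
      by (intro continuous_imp_integrable_real continuous_intros contG) auto
  qed (use pw in auto)
  also have "\<dots> = l * ((\<integral>t. G' t \<partial>leb) / 2 + 2 * M)"
    using intG by (simp add: integrable_restrict_space lebesgue_on_UNIV_eq measure_restrict_space)
  also have "\<dots> \<le> l * (3 * M)"
    using IG l by (intro mult_left_mono) auto
  also have "\<dots> \<le> 2 * (real k)\<^sup>2 * (3 * M)"
    using M l2 by (intro mult_right_mono) auto
  also have "\<dots> = 6 * real k ^ (4 * r - 2) * (real k + 1/2)"
    by (simp add: M_def r power2_eq_square)
  finally show ?thesis by (simp add: y_def r)
qed

section \<open>Bounds in \<open>L_q\<close>\<close>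

text \<open>
  Membership in \<open>L_q\<close> together with a bound on the norm, for finite and infinite \<open>q\<close> at once. Formulating
  it with the nonnegative integral allows sums and limits to be treated without separate
  integrability arguments.
\<close>
definition Lq_bounded :: "ennreal \<Rightarrow> real \<Rightarrow> (real \<Rightarrow> real) \<Rightarrow> bool" where
  "Lq_bounded q B f \<longleftrightarrow> f \<in> borel_measurable leb \<and>
     (if q = \<infinity> then AE t in leb. \<bar>f t\<bar> \<le> B
      else (\<integral>\<^sup>+t. ennreal (\<bar>f t\<bar> powr enn2real q) \<partial>leb) \<le> ennreal (B powr enn2real q))"

lemma enn2real_ge_1: "1 \<le> q \<Longrightarrow> q \<noteq> \<infinity> \<Longrightarrow> 1 \<le> enn2real q"
  by (cases q) auto

lemma emeasure_leb: "emeasure leb (space leb) = 2"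
  by (simp add: emeasure_restrict_space)

lemma esssup_abs_nonneg: "0 \<le> esssup leb (\<lambda>t. ereal \<bar>f t\<bar>)"
proof (cases "(\<lambda>t. ereal \<bar>f t\<bar>) \<in> borel_measurable leb")
  case True
  have "0 = esssup leb (\<lambda>t. 0 :: ereal)"
    by (rule esssup_const[symmetric]) (simp only: emeasure_leb; simp)
  also have "\<dots> \<le> esssup leb (\<lambda>t. ereal \<bar>f t\<bar>)"
    by (rule esssup_mono) auto
  finally show ?thesis .
qed (simp add: esssup_non_measurable)

lemma Lq_norm_nonneg: "0 \<le> Lq_norm q f"
  by (simp add: Lq_norm_def real_of_ereal_pos esssup_abs_nonneg)

lemma Lq_bounded_iff:
  assumes "1 \<le> q" "0 \<le> B"
  shows "Lq_bounded q B f \<longleftrightarrow> f \<in> Lq_space q \<and> Lq_norm q f \<le> B"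
proof (cases "f \<in> borel_measurable leb")
  case False
  then show ?thesis by (simp add: Lq_bounded_def Lq_space_def)
next
  case meas [measurable]: True
  show ?thesis
  proof (cases "q = \<infinity>")
    case True
    define E where "E = esssup leb (\<lambda>t. ereal \<bar>f t\<bar>)"
    have E0: "0 \<le> E" unfolding E_def by (rule esssup_abs_nonneg)
    have "(AE t in leb. \<bar>f t\<bar> \<le> B) \<longleftrightarrow> E \<le> ereal B"
    proof
      assume "AE t in leb. \<bar>f t\<bar> \<le> B"
      then show "E \<le> ereal B" unfolding E_def by (intro esssup_I) auto
    next
      assume E: "E \<le> ereal B"
      have "AE t in leb. ereal \<bar>f t\<bar> \<le> E" unfolding E_def by (rule esssup_AE)
      then show "AE t in leb. \<bar>f t\<bar> \<le> B"
        by eventually_elim (use E in \<open>metis order_trans ereal_less_eq(3)\<close>)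
    qed
    also have "E \<le> ereal B \<longleftrightarrow> E < \<infinity> \<and> real_of_ereal E \<le> B"
      using E0 by (cases E) auto
    finally show ?thesis
      using True by (simp add: Lq_bounded_def Lq_space_def Lq_norm_def E_def)
  next
    case False
    define Q where "Q = enn2real q"
    have Q: "Q \<ge> 1" using enn2real_ge_1[OF assms(1) False] by (simp add: Q_def)
    let ?h = "\<lambda>t. \<bar>f t\<bar> powr Q"
    have "(\<integral>\<^sup>+t. ennreal (?h t) \<partial>leb) \<le> ennreal (B powr Q)
        \<longleftrightarrow> integrable leb ?h \<and> (\<integral>t. ?h t \<partial>leb) powr (1/Q) \<le> B"
    proof
      assume L: "(\<integral>\<^sup>+t. ennreal (?h t) \<partial>leb) \<le> ennreal (B powr Q)"
      have int: "integrable leb ?h"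
        by (rule integrableI_bounded)
          (use L in \<open>auto intro: le_less_trans\<close>)
      then have "(\<integral>t. ?h t \<partial>leb) \<le> B powr Q"
        using L by (simp add: nn_integral_eq_integral)
      then have "(\<integral>t. ?h t \<partial>leb) powr (1/Q) \<le> (B powr Q) powr (1/Q)"
        using Q by (intro powr_mono2) auto
      also have "\<dots> = B" using Q assms(2) by (simp add: powr_powr)
      finally show "integrable leb ?h \<and> (\<integral>t. ?h t \<partial>leb) powr (1/Q) \<le> B" using int by simp
    next
      assume R: "integrable leb ?h \<and> (\<integral>t. ?h t \<partial>leb) powr (1/Q) \<le> B"
      have "(\<integral>t. ?h t \<partial>leb) = ((\<integral>t. ?h t \<partial>leb) powr (1/Q)) powr Q"
        using Q by (simp add: powr_powr)
      also have "\<dots> \<le> B powr Q"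
        using R Q by (intro powr_mono2) auto
      finally show "(\<integral>\<^sup>+t. ennreal (?h t) \<partial>leb) \<le> ennreal (B powr Q)"
        using R by (simp add: nn_integral_eq_integral ennreal_leI)
    qed
    then show ?thesis
      using False by (simp add: Lq_bounded_def Lq_space_def Lq_norm_def Q_def)
  qed
qed

lemma Lq_bounded_zero: "Lq_bounded q 0 (\<lambda>t. 0)"
  by (simp add: Lq_bounded_def)

lemma Lq_bounded_cmult:
  assumes "Lq_bounded q B f" "0 \<le> B"
  shows "Lq_bounded q (\<bar>c\<bar> * B) (\<lambda>t. c * f t)"
proof (cases "q = \<infinity>")
  case True
  have "AE t in leb. \<bar>f t\<bar> \<le> B" using assms True by (simp add: Lq_bounded_def)
  then have "AE t in leb. \<bar>c * f t\<bar> \<le> \<bar>c\<bar> * B"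
    by eventually_elim (auto simp: abs_mult intro: mult_left_mono)
  then show ?thesis using assms True
    by (auto simp: Lq_bounded_def intro: borel_measurable_times)
next
  case False
  define Q where "Q = enn2real q"
  have [measurable]: "f \<in> borel_measurable leb" using assms by (simp add: Lq_bounded_def)
  have "(\<integral>\<^sup>+t. ennreal (\<bar>c * f t\<bar> powr Q) \<partial>leb)
      = (\<integral>\<^sup>+t. ennreal (\<bar>c\<bar> powr Q) * ennreal (\<bar>f t\<bar> powr Q) \<partial>leb)"
    by (simp add: abs_mult powr_mult ennreal_mult)
  also have "\<dots> = ennreal (\<bar>c\<bar> powr Q) * (\<integral>\<^sup>+t. ennreal (\<bar>f t\<bar> powr Q) \<partial>leb)"
    by (rule nn_integral_cmult) measurable
  also have "\<dots> \<le> ennreal (\<bar>c\<bar> powr Q) * ennreal (B powr Q)"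
    using assms False by (intro mult_left_mono) (auto simp: Lq_bounded_def Q_def)
  also have "\<dots> = ennreal ((\<bar>c\<bar> * B) powr Q)"
    using assms by (simp add: powr_mult ennreal_mult)
  finally show ?thesis using False by (simp add: Lq_bounded_def Q_def)
qed

text \<open>
  For finite \<open>q\<close> this is Fatou's lemma.
\<close>
lemma Lq_bounded_limit:
  assumes q: "1 \<le> q"
    and F: "\<And>n. Lq_bounded q (X n) (F n)"
    and X: "X \<longlonglongrightarrow> B" "\<And>n. 0 \<le> X n"
    and f [measurable]: "f \<in> borel_measurable leb"
    and lim: "AE t in leb. (\<lambda>n. F n t) \<longlonglongrightarrow> f t"
  shows "Lq_bounded q B f"
proof (cases "q = \<infinity>")
  case True
  have "AE t in leb. \<forall>n. \<bar>F n t\<bar> \<le> X n"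
    unfolding AE_all_countable using F True by (simp add: Lq_bounded_def)
  with lim have "AE t in leb. \<bar>f t\<bar> \<le> B"
    by eventually_elim (rule LIMSEQ_le[OF tendsto_rabs X(1)], auto)
  then show ?thesis using True by (simp add: Lq_bounded_def)
next
  case False
  define Q where "Q = enn2real q"
  have Q: "Q \<ge> 1" using enn2real_ge_1[OF q False] by (simp add: Q_def)
  have [measurable]: "F n \<in> borel_measurable leb" for n using F by (simp add: Lq_bounded_def)
  have "(\<integral>\<^sup>+t. ennreal (\<bar>f t\<bar> powr Q) \<partial>leb) = (\<integral>\<^sup>+t. liminf (\<lambda>n. ennreal (\<bar>F n t\<bar> powr Q)) \<partial>leb)"
  proof (rule nn_integral_cong_AE)
    from lim show "AE t in leb. ennreal (\<bar>f t\<bar> powr Q) = liminf (\<lambda>n. ennreal (\<bar>F n t\<bar> powr Q))"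
    proof eventually_elim
      case (elim t)
      have "(\<lambda>n. ennreal (\<bar>F n t\<bar> powr Q)) \<longlonglongrightarrow> ennreal (\<bar>f t\<bar> powr Q)"
        using Q by (intro tendsto_ennrealI tendsto_powr' tendsto_rabs elim tendsto_const) auto
      then show ?case by (intro lim_imp_Liminf[symmetric]) auto
    qed
  qed
  also have "\<dots> \<le> liminf (\<lambda>n. \<integral>\<^sup>+t. ennreal (\<bar>F n t\<bar> powr Q) \<partial>leb)"
    by (rule nn_integral_liminf) measurable
  also have "\<dots> \<le> liminf (\<lambda>n. ennreal (X n powr Q))"
    using F False by (intro Liminf_mono always_eventually) (simp add: Lq_bounded_def Q_def)
  also have "\<dots> = ennreal (B powr Q)"
  proof (intro lim_imp_Liminf)
    show "(\<lambda>n. ennreal (X n powr Q)) \<longlonglongrightarrow> ennreal (B powr Q)"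
      using Q X by (intro tendsto_ennrealI tendsto_powr' tendsto_const) auto
  qed auto
  finally show ?thesis using False by (simp add: Lq_bounded_def Q_def)
qed

lemma Lq_bounded_mono:
  assumes "Lq_bounded q A f" "0 \<le> A" "A \<le> B"
  shows "Lq_bounded q B f"
proof (cases "q = \<infinity>")
  case True
  have "AE t in leb. \<bar>f t\<bar> \<le> A" using assms True by (simp add: Lq_bounded_def)
  then have "AE t in leb. \<bar>f t\<bar> \<le> B"
    by eventually_elim (use assms in auto)
  then show ?thesis using assms True by (simp add: Lq_bounded_def)
next
  case False
  have "A powr enn2real q \<le> B powr enn2real q" using assms by (intro powr_mono2) auto
  then show ?thesis using assms False
    by (auto simp: Lq_bounded_def intro: order_trans ennreal_leI)
qed

text \<open>
  The boundary point \<open>0\<close> is needed because the functions to which convexity is applied have zeros.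
  It rests on \<open>t powr p \<le> t\<close> for \<open>t\<close> in \<open>[0, 1]\<close>.
\<close>
lemma convex_on_powr_nonneg:
  fixes p :: real
  assumes "p \<ge> 1"
  shows "convex_on {0..} (\<lambda>x. x powr p)"
proof (rule convex_on_linorderI)
  fix t x y :: real
  assume t: "t > 0" "t < 1" and x: "x \<in> {0..}" and y: "y \<in> {0..}" and "x < y"
  show "((1 - t) *\<^sub>R x + t *\<^sub>R y) powr p \<le> (1 - t) * x powr p + t * y powr p"
  proof (cases "x = 0")
    case True
    have "t powr p \<le> t powr 1" using t assms by (intro powr_mono') auto
    then have "t powr p * y powr p \<le> t * y powr p" using t by (intro mult_right_mono) auto
    then show ?thesis using True t y by (simp add: powr_mult)
  next
    case False
    then show ?thesis
      using convex_onD[OF powr_convex[OF assms], of t x y] t x \<open>x < y\<close> by simp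
  qed
qed simp

text \<open>
  Minkowski's inequality: \<open>(f + g) / (A + B)\<close> is the convex combination of \<open>f / A\<close> and \<open>g / B\<close> with
  weights \<open>A / (A + B)\<close> and \<open>B / (A + B)\<close>, and \<open>x powr q\<close> is convex.
\<close>
lemma Lq_bounded_add_pos:
  assumes q: "1 \<le> q" and f: "Lq_bounded q A f" and g: "Lq_bounded q B g" and pos: "0 < A" "0 < B"
  shows "Lq_bounded q (A + B) (\<lambda>t. f t + g t)"
proof (cases "q = \<infinity>")
  case True
  have "AE t in leb. \<bar>f t\<bar> \<le> A" "AE t in leb. \<bar>g t\<bar> \<le> B"
    using f g True by (simp_all add: Lq_bounded_def)
  then have "AE t in leb. \<bar>f t + g t\<bar> \<le> A + B" by eventually_elim auto
  then show ?thesis using f g True by (auto simp: Lq_bounded_def intro: borel_measurable_add)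
next
  case False
  define Q where "Q = enn2real q"
  have Q: "Q \<ge> 1" using enn2real_ge_1[OF q False] by (simp add: Q_def)
  have [measurable]: "f \<in> borel_measurable leb" "g \<in> borel_measurable leb"
    using f g by (simp_all add: Lq_bounded_def)
  define u v where "u = (A + B) powr Q * (A / (A + B)) / A powr Q"
    and "v = (A + B) powr Q * (B / (A + B)) / B powr Q"
  have uv: "u \<ge> 0" "v \<ge> 0" using pos by (simp_all add: u_def v_def)
  have pw: "\<bar>f t + g t\<bar> powr Q \<le> u * \<bar>f t\<bar> powr Q + v * \<bar>g t\<bar> powr Q" for t
  proof -
    let ?a = "A / (A + B)" and ?b = "B / (A + B)"
    have ab: "?a + ?b = 1" "?a \<ge> 0" "?b \<ge> 0"
      using pos by (simp_all flip: add_divide_distrib)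
    have "A + B \<noteq> 0" using pos by linarith
    then have "(A + B) * (?a * (\<bar>f t\<bar> / A) + ?b * (\<bar>g t\<bar> / B)) = \<bar>f t\<bar> + \<bar>g t\<bar>"
      using pos by (simp add: distrib_left)
    then have "\<bar>f t + g t\<bar> powr Q \<le> ((A + B) * (?a * (\<bar>f t\<bar> / A) + ?b * (\<bar>g t\<bar> / B))) powr Q"
      using Q by (intro powr_mono2) auto
    also have "\<dots> = (A + B) powr Q * (?a * (\<bar>f t\<bar> / A) + ?b * (\<bar>g t\<bar> / B)) powr Q"
      using pos by (intro powr_mult)
    also have "\<dots> \<le> (A + B) powr Q * (?a * (\<bar>f t\<bar> / A) powr Q + ?b * (\<bar>g t\<bar> / B) powr Q)"
    proof (rule mult_left_mono)
      have b: "1 - ?b = ?a" "?b \<le> 1" using ab by linarith+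
      show "(?a * (\<bar>f t\<bar> / A) + ?b * (\<bar>g t\<bar> / B)) powr Q
          \<le> ?a * (\<bar>f t\<bar> / A) powr Q + ?b * (\<bar>g t\<bar> / B) powr Q"
        using convex_onD[OF convex_on_powr_nonneg[OF Q] ab(3) b(2), of "\<bar>f t\<bar> / A" "\<bar>g t\<bar> / B"] pos
        unfolding b(1) by simp
    qed simp
    also have "\<dots> = u * \<bar>f t\<bar> powr Q + v * \<bar>g t\<bar> powr Q"
      using pos by (simp add: u_def v_def powr_divide algebra_simps)
    finally show ?thesis .
  qed
  have "(\<integral>\<^sup>+t. ennreal (\<bar>f t + g t\<bar> powr Q) \<partial>leb)
      \<le> (\<integral>\<^sup>+t. ennreal u * ennreal (\<bar>f t\<bar> powr Q) + ennreal v * ennreal (\<bar>g t\<bar> powr Q) \<partial>leb)"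
    using pw uv by (intro nn_integral_mono) (simp add: ennreal_leI flip: ennreal_mult ennreal_plus)
  also have "\<dots> = ennreal u * (\<integral>\<^sup>+t. ennreal (\<bar>f t\<bar> powr Q) \<partial>leb)
      + ennreal v * (\<integral>\<^sup>+t. ennreal (\<bar>g t\<bar> powr Q) \<partial>leb)"
    by (simp add: nn_integral_add nn_integral_cmult)
  also have "\<dots> \<le> ennreal u * ennreal (A powr Q) + ennreal v * ennreal (B powr Q)"
    using f g False by (intro add_mono mult_left_mono) (auto simp: Lq_bounded_def Q_def)
  also have "\<dots> = ennreal (u * A powr Q + v * B powr Q)"
    using uv by (simp add: ennreal_mult)
  also have "u * A powr Q + v * B powr Q = (A + B) powr Q * (A / (A + B) + B / (A + B))"
  proof -
    have "u * A powr Q = (A + B) powr Q * (A / (A + B))"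
      using pos by (intro nonzero_eq_divide_eq[THEN iffD1]) (auto simp: u_def)
    moreover have "v * B powr Q = (A + B) powr Q * (B / (A + B))"
      using pos by (intro nonzero_eq_divide_eq[THEN iffD1]) (auto simp: v_def)
    ultimately show ?thesis by (simp only: distrib_left)
  qed
  also have "A / (A + B) + B / (A + B) = 1"
    using pos by (simp flip: add_divide_distrib)
  finally show ?thesis using False by (simp add: Lq_bounded_def Q_def)
qed

text \<open>
  Vanishing bounds, by which the preceding argument would divide, are approximated by positive ones.
\<close>
lemma Lq_bounded_add:
  assumes q: "1 \<le> q" and f: "Lq_bounded q A f" and g: "Lq_bounded q B g" and "0 \<le> A" "0 \<le> B"
  shows "Lq_bounded q (A + B) (\<lambda>t. f t + g t)"
proof (rule Lq_bounded_limit[OF q])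
  define e where "e n = 1 / real (Suc n)" for n
  have e: "0 < e n" for n by (simp add: e_def)
  show "Lq_bounded q ((A + e n) + (B + e n)) (\<lambda>t. f t + g t)" for n
    using Lq_bounded_mono[OF f, of "A + e n"] Lq_bounded_mono[OF g, of "B + e n"] e[of n] assms
    by (intro Lq_bounded_add_pos[OF q]) auto
  have "e \<longlonglongrightarrow> 0" using LIMSEQ_Suc[OF lim_1_over_n] by (simp add: e_def[abs_def])
  then have "(\<lambda>n. (A + e n) + (B + e n)) \<longlonglongrightarrow> (A + 0) + (B + 0)"
    by (intro tendsto_intros)
  then show "(\<lambda>n. (A + e n) + (B + e n)) \<longlonglongrightarrow> A + B" by simp
  show "0 \<le> (A + e n) + (B + e n)" for n using assms e[of n] by simp
  show "(\<lambda>t. f t + g t) \<in> borel_measurable leb"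
    using f g by (auto simp: Lq_bounded_def intro: borel_measurable_add)
qed auto

lemma Lq_bounded_sum:
  assumes q: "1 \<le> q" and "finite I"
    and "\<And>i. i \<in> I \<Longrightarrow> Lq_bounded q (B i) (f i)" "\<And>i. i \<in> I \<Longrightarrow> 0 \<le> B i"
  shows "Lq_bounded q (\<Sum>i\<in>I. B i) (\<lambda>t. \<Sum>i\<in>I. f i t)"
  using assms(2-)
proof (induction I rule: finite_induct)
  case empty
  then show ?case by (simp add: Lq_bounded_zero)
next
  case (insert i I)
  then show ?case
    by (simp add: Lq_bounded_add[OF q] sum_nonneg)
qed

text \<open>
  On a finite measure space \<open>L_q\<close> lies in \<open>L_1\<close>, since \<open>\<bar>f\<bar> \<le> B + B (\<bar>f\<bar> / B) powr q\<close>. The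
  interval has measure \<open>2\<close>, whence the factor \<open>2 + 1\<close>.
\<close>
lemma nn_integral_le_of_Lq_bounded:
  assumes q: "1 \<le> q" and f: "Lq_bounded q B f" and B: "0 < B"
  shows "(\<integral>\<^sup>+t. ennreal \<bar>f t\<bar> \<partial>leb) \<le> ennreal (3 * B)"
proof (cases "q = \<infinity>")
  case True
  then have "AE t in leb. \<bar>f t\<bar> \<le> B" using f by (simp add: Lq_bounded_def)
  then have "(\<integral>\<^sup>+t. ennreal \<bar>f t\<bar> \<partial>leb) \<le> (\<integral>\<^sup>+t. ennreal B \<partial>leb)"
    by (intro nn_integral_mono_AE) (auto elim!: eventually_mono intro: ennreal_leI)
  also have "\<dots> = ennreal (B * 2)"
    using B by (simp add: emeasure_leb[simplified] ennreal_mult)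
  also have "\<dots> \<le> ennreal (3 * B)" using B by (intro ennreal_leI) auto
  finally show ?thesis .
next
  case False
  define Q where "Q = enn2real q"
  have Q: "Q \<ge> 1" using enn2real_ge_1[OF q False] by (simp add: Q_def)
  have [measurable]: "f \<in> borel_measurable leb" using f by (simp add: Lq_bounded_def)
  define u where "u = B / B powr Q"
  have u: "u \<ge> 0" using B by (simp add: u_def)
  have pw: "\<bar>f t\<bar> \<le> B + u * \<bar>f t\<bar> powr Q" for t
  proof (cases "\<bar>f t\<bar> \<le> B")
    case True
    then show ?thesis using u by (simp add: add_increasing2)
  next
    case False
    then have "1 \<le> \<bar>f t\<bar> / B" using B by simp
    then have "(\<bar>f t\<bar> / B) powr 1 \<le> (\<bar>f t\<bar> / B) powr Q" using Q by (intro powr_mono) auto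
    then have "\<bar>f t\<bar> \<le> u * \<bar>f t\<bar> powr Q"
      using B by (simp add: u_def powr_divide field_simps)
    then show ?thesis using B by simp
  qed
  have "(\<integral>\<^sup>+t. ennreal \<bar>f t\<bar> \<partial>leb) \<le> (\<integral>\<^sup>+t. ennreal B + ennreal u * ennreal (\<bar>f t\<bar> powr Q) \<partial>leb)"
    using pw u B by (intro nn_integral_mono) (simp add: ennreal_leI flip: ennreal_mult ennreal_plus)
  also have "\<dots> = ennreal (B * 2) + ennreal u * (\<integral>\<^sup>+t. ennreal (\<bar>f t\<bar> powr Q) \<partial>leb)"
    using B by (simp add: nn_integral_add nn_integral_cmult emeasure_leb[simplified] ennreal_mult)
  also have "\<dots> \<le> ennreal (B * 2) + ennreal u * ennreal (B powr Q)"
    using f False by (intro add_mono mult_left_mono) (auto simp: Lq_bounded_def Q_def)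
  also have "\<dots> = ennreal (3 * B)"
    using B u by (simp add: u_def flip: ennreal_mult ennreal_plus)
  finally show ?thesis .
qed

text \<open>
  The integral of \<open>\<Sum>k. \<bar>h k t\<bar>\<close> is finite by monotone convergence, so the sum is finite almost
  everywhere.
\<close>
lemma AE_summable_of_Lq_bounded:
  assumes q: "1 \<le> q" and h: "\<And>k. Lq_bounded q (b k) (h k)"
    and b: "\<And>k. 0 \<le> b k" "summable b"
  shows "AE t in leb. summable (\<lambda>k. h k t)"
proof -
  \<comment> \<open>The \<open>L_1\<close> bound is available for positive bounds only; a geometric sequence keeps them summable.\<close>
  define b' where "b' k = b k + (1/2) ^ k" for k
  have b'0: "b' k > 0" for k using b(1)[of k] by (simp add: b'_def add_nonneg_pos)
  have b's: "summable (\<lambda>k. 3 * b' k)"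
    unfolding b'_def by (intro summable_mult summable_add b summable_geometric) auto
  have h': "Lq_bounded q (b' k) (h k)" for k
    by (rule Lq_bounded_mono[OF h]) (auto simp: b b'_def)
  have [measurable]: "h k \<in> borel_measurable leb" for k using h by (simp add: Lq_bounded_def)
  have "(\<integral>\<^sup>+t. (\<Sum>k. ennreal \<bar>h k t\<bar>) \<partial>leb) = (\<Sum>k. \<integral>\<^sup>+t. ennreal \<bar>h k t\<bar> \<partial>leb)"
    by (rule nn_integral_suminf) measurable
  also have "\<dots> \<le> (\<Sum>k. ennreal (3 * b' k))"
    by (intro suminf_le nn_integral_le_of_Lq_bounded[OF q h' b'0]) auto
  also have "\<dots> < \<infinity>"
    using b's b'0 by (simp add: suminf_ennreal2 less_imp_le)
  finally have "AE t in leb. (\<Sum>k. ennreal \<bar>h k t\<bar>) \<noteq> \<infinity>"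
    by (intro nn_integral_PInf_AE) auto
  then show ?thesis
  proof eventually_elim
    case (elim t)
    then have "summable (\<lambda>k. \<bar>h k t\<bar>)"
      by (intro summable_suminf_not_top) auto
    then show ?case by (rule summable_rabs_cancel)
  qed
qed

text \<open>
  Completeness of \<open>L_q\<close>, in the form of the convergence of absolutely convergent series: the pointwise
  sum is the limit almost everywhere of the partial sums.
\<close>
lemma Lq_bounded_suminf:
  assumes q: "1 \<le> q" and h: "\<And>k. Lq_bounded q (b k) (h k)"
    and b: "\<And>k. 0 \<le> b k" "summable b"
  shows "Lq_bounded q (\<Sum>k. b k) (\<lambda>t. \<Sum>k. h k t)"
proof (rule Lq_bounded_limit[OF q])
  show "Lq_bounded q (\<Sum>k<n. b k) (\<lambda>t. \<Sum>k<n. h k t)" for n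
    by (rule Lq_bounded_sum[OF q]) (auto intro: h b)
  show "(\<lambda>n. \<Sum>k<n. b k) \<longlonglongrightarrow> (\<Sum>k. b k)" by (rule summable_LIMSEQ[OF b(2)])
  have [measurable]: "h k \<in> borel_measurable leb" for k using h by (simp add: Lq_bounded_def)
  show "(\<lambda>t. \<Sum>k. h k t) \<in> borel_measurable leb" by measurable
  show "AE t in leb. (\<lambda>n. \<Sum>k<n. h k t) \<longlonglongrightarrow> (\<Sum>k. h k t)"
    using AE_summable_of_Lq_bounded[OF q h b] by eventually_elim (rule summable_LIMSEQ)
qed (auto intro: sum_nonneg b)

text \<open>
  The remainder is, almost everywhere, the sum of the shifted series. A constant sequence of
  functions transfers the bound along this equality almost everywhere.
\<close>
lemma Lq_bounded_suminf_remainder: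
  assumes q: "1 \<le> q" and h: "\<And>k. Lq_bounded q (b k) (h k)"
    and b: "\<And>k. 0 \<le> b k" "summable b"
  shows "Lq_bounded q (\<Sum>k. b (k + n)) (\<lambda>t. (\<Sum>k. h k t) - (\<Sum>k<n. h k t))"
proof (rule Lq_bounded_limit[OF q])
  have [measurable]: "h k \<in> borel_measurable leb" for k using h by (simp add: Lq_bounded_def)
  have bn: "summable (\<lambda>k. b (k + n))" using b(2) by (simp add: summable_iff_shift)
  show "Lq_bounded q (\<Sum>k. b (k + n)) (\<lambda>t. \<Sum>k. h (k + n) t)" for m :: nat
    by (rule Lq_bounded_suminf[OF q]) (auto intro: h b bn)
  show "0 \<le> (\<Sum>k. b (k + n))" using bn b by (intro suminf_nonneg) auto
  show "(\<lambda>t. (\<Sum>k. h k t) - (\<Sum>k<n. h k t)) \<in> borel_measurable leb" by measurable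
  show "AE t in leb. (\<lambda>m::nat. \<Sum>k. h (k + n) t) \<longlonglongrightarrow> (\<Sum>k. h k t) - (\<Sum>k<n. h k t)"
    using AE_summable_of_Lq_bounded[OF q h b]
    by eventually_elim (simp only: suminf_minus_initial_segment[symmetric] tendsto_const)
qed auto

section \<open>Growth of the derivatives in \<open>L_q\<close>\<close>

lemma enn2real_two_divide:
  assumes "2 \<le> q" "q \<noteq> \<infinity>"
  shows "enn2real (2 / q) = 2 / enn2real q" "2 \<le> enn2real q"
proof -
  obtain Q where Q: "q = ennreal Q" "0 \<le> Q" using assms(2) by (cases q) auto
  with assms(1) show "2 \<le> enn2real q" by (simp flip: ennreal_numeral)
  with Q have "2 / q = ennreal (2 / Q)" by (simp add: divide_ennreal flip: ennreal_numeral)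
  with Q show "enn2real (2 / q) = 2 / enn2real q" by simp
qed

lemma enn2real_two_divide_le_1:
  assumes "2 \<le> q"
  shows "enn2real (2 / q) \<le> 1"
proof (cases "q = \<infinity>")
  case False
  then show ?thesis using enn2real_two_divide[OF assms False] by simp
qed simp

text \<open>
  The power \<open>\<bar>y\<bar> powr q\<close> is at most \<open>M powr (q - 2) * y\<^sup>2\<close> for an upper bound \<open>M\<close> of \<open>\<bar>y\<bar>\<close>, and
  the bounds for the supremum and for the integral of \<open>y\<^sup>2\<close> multiply to the stated power. The
  common constant \<open>4\<close> covers both. For \<open>k = 0\<close> both the derivative and the bound, by
  \<open>0 powr x = 0\<close>, are zero.
\<close>
lemma Lq_bounded_legendre_deriv:
  assumes q: "2 \<le> q" and r: "1 \<le> r"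
  shows "Lq_bounded q (4 * real k powr (2 * real r + 1/2 - enn2real (2 / q))) (legendre_deriv r k)"
proof (cases "k = 0")
  case True
  have "legendre_deriv r 0 = (\<lambda>t. 0)" using r by (intro ext legendre_deriv_eq_0) auto
  then show ?thesis using True by (simp add: Lq_bounded_zero)
next
  case False
  then have k: "k \<ge> 1" by simp
  define y where "y = legendre_deriv r k"
  define M where "M = 4 * real k powr (2 * real r + 1/2)"
  have M0: "M > 0" using k by (simp add: M_def)
  have [measurable]: "y \<in> borel_measurable leb" by (simp add: y_def)
  have half: "real k + 1/2 \<le> 2 * real k" using k by simp
  have M: "\<bar>y t\<bar> \<le> M" if "t \<in> {-1..1}" for t
  proof (rule power2_le_imp_le)
    have "(\<bar>y t\<bar>)\<^sup>2 \<le> real k ^ (4 * r) * (real k + 1/2)"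
      using legendre_deriv_square_le[OF k that] by (simp add: y_def)
    also have "\<dots> \<le> real k ^ (4 * r) * (16 * real k)"
      using half by (intro mult_left_mono) auto
    also have "\<dots> = 16 * (real k powr real (4 * r) * real k powr 1)"
      using powr_realpow[of "real k" "4 * r"] k by simp
    also have "\<dots> = 16 * real k powr ((2 * real r + 1/2) + (2 * real r + 1/2))"
      by (simp only: powr_add[symmetric]) simp
    also have "\<dots> = M\<^sup>2"
      by (simp only: M_def powr_add power2_eq_square)
    finally show "(\<bar>y t\<bar>)\<^sup>2 \<le> M\<^sup>2" .
  qed (use M0 in simp)
  show ?thesis
  proof (cases "q = \<infinity>")
    case True
    then show ?thesis using M by (auto simp: Lq_bounded_def y_def M_def intro!: AE_I2)
  next
    case False
    define Q where "Q = enn2real q"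
    have Q: "Q \<ge> 2" "enn2real (2 / q) = 2 / Q"
      using enn2real_two_divide[OF q False] by (simp_all add: Q_def)
    have pw: "\<bar>y t\<bar> powr Q \<le> M powr (Q - 2) * (y t)\<^sup>2" if "t \<in> {-1..1}" for t
    proof (cases "y t = 0")
      case False
      have "\<bar>y t\<bar> powr Q = \<bar>y t\<bar> powr (Q - 2) * (y t)\<^sup>2"
        using False by (simp add: powr_diff)
      also have "\<dots> \<le> M powr (Q - 2) * (y t)\<^sup>2"
        using M[OF that] Q by (intro mult_right_mono powr_mono2) auto
      finally show ?thesis .
    qed (use Q in simp)
    have int: "integrable leb (\<lambda>t. M powr (Q - 2) * (y t)\<^sup>2)"
      unfolding y_def by (intro continuous_imp_integrable_real continuous_intros)
    have I2: "(\<integral>t. (y t)\<^sup>2 \<partial>leb) \<le> 16 * real k powr (4 * real r - 1)"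
    proof -
      have "(\<integral>t. (y t)\<^sup>2 \<partial>leb) \<le> 6 * real k ^ (4 * r - 2) * (real k + 1/2)"
        unfolding y_def by (rule integral_legendre_deriv_square_le[OF k r])
      also have "\<dots> \<le> 6 * real k ^ (4 * r - 2) * (2 * real k)"
        using half by (intro mult_left_mono) auto
      also have "\<dots> = 12 * (real k powr real (4 * r - 2) * real k powr 1)"
        using k by (simp add: powr_realpow)
      also have "\<dots> = 12 * real k powr (real (4 * r - 2) + 1)"
        by (simp only: powr_add)
      also have "real (4 * r - 2) + 1 = 4 * real r - 1"
        using r by (simp add: of_nat_diff)
      finally show ?thesis by (rule order_trans) simp
    qed
    have "(\<integral>\<^sup>+t. ennreal (\<bar>y t\<bar> powr Q) \<partial>leb) \<le> (\<integral>\<^sup>+t. ennreal (M powr (Q - 2) * (y t)\<^sup>2) \<partial>leb)"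
      by (intro nn_integral_mono ennreal_leI pw) auto
    also have "\<dots> = ennreal (M powr (Q - 2) * (\<integral>t. (y t)\<^sup>2 \<partial>leb))"
      using int by (simp add: nn_integral_eq_integral)
    also have "\<dots> \<le> ennreal (M powr (Q - 2) * (16 * real k powr (4 * real r - 1)))"
      by (intro ennreal_leI mult_left_mono I2) auto
    also have "M powr (Q - 2) * (16 * real k powr (4 * real r - 1))
        = (4 powr (Q - 2) * 4 powr 2) * real k powr ((2 * real r + 1/2) * (Q - 2) + (4 * real r - 1))"
    proof -
      have "M powr (Q - 2) = 4 powr (Q - 2) * real k powr ((2 * real r + 1/2) * (Q - 2))"
        by (simp add: M_def powr_mult powr_powr)
      then show ?thesis by (simp only: powr_add) simp
    qed
    also have "\<dots> = 4 powr Q * real k powr ((2 * real r + 1/2 - 2 / Q) * Q)"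
    proof -
      have "4 powr (Q - 2) * 4 powr 2 = (4::real) powr (Q - 2 + 2)"
        by (simp only: powr_add)
      moreover have "(2 * real r + 1/2) * (Q - 2) + (4 * real r - 1) = (2 * real r + 1/2 - 2 / Q) * Q"
        using Q(1) by (simp add: field_simps)
      ultimately show ?thesis by simp
    qed
    also have "\<dots> = (4 * real k powr (2 * real r + 1/2 - 2 / Q)) powr Q"
      by (simp add: powr_mult powr_powr)
    finally show ?thesis
      using False by (simp add: Lq_bounded_def y_def Q Q_def[symmetric])
  qed
qed

lemma Lq_bounded_legendre_deriv_sum:
  assumes q: "2 \<le> q" and r: "1 \<le> r" and A: "finite A"
  shows "Lq_bounded q (\<Sum>k\<in>A. \<bar>c k\<bar> * (4 * real k powr (2 * real r + 1/2 - enn2real (2 / q))))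
           (\<lambda>t. \<Sum>k\<in>A. c k * legendre_deriv r k t)"
proof -
  have "1 \<le> q" using q by (rule order_trans[rotated]) simp
  then show ?thesis
    by (intro Lq_bounded_sum A Lq_bounded_cmult Lq_bounded_legendre_deriv q r) auto
qed

section \<open>Sums over weighted sequences\<close>

lemma enn2real_one_divide_bounds:
  assumes "1 \<le> p"
  shows "0 \<le> enn2real (1 / p)" "enn2real (1 / p) \<le> 1"
proof -
  have "1 / p \<le> 1" using assms by (simp add: divide_le_posI_ennreal order_less_le_trans[OF zero_less_one])
  then show "enn2real (1 / p) \<le> 1" using enn2real_mono[of "1/p" 1] by simp
qed simp

text \<open>
  The power mean inequality: Jensen's inequality for \<open>x powr s\<close> and the uniform weights on \<open>A\<close>.
\<close>
lemma sum_le_card_powr_mult: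
  fixes x :: "'a \<Rightarrow> real" and s :: real
  assumes "s \<ge> 1" "\<And>i. i \<in> A \<Longrightarrow> 0 \<le> x i"
  shows "(\<Sum>i\<in>A. x i) \<le> real (card A) powr (1 - 1/s) * (\<Sum>i\<in>A. x i powr s) powr (1/s)"
proof (cases "finite A \<and> A \<noteq> {}")
  case True
  define c where "c = real (card A)"
  have c: "c > 0" using True by (simp add: c_def card_gt_0_iff)
  define S where "S = (\<Sum>i\<in>A. x i)"
  have S: "S \<ge> 0" unfolding S_def using assms by (intro sum_nonneg) auto
  have "(\<Sum>i\<in>A. (1/c) *\<^sub>R x i) powr s \<le> (\<Sum>i\<in>A. (1/c) * x i powr s)"
    by (rule convex_on_sum[OF _ _ convex_on_powr_nonneg[OF assms(1)]])
      (use True c assms in \<open>auto simp: c_def\<close>)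
  then have "(S / c) powr s \<le> (\<Sum>i\<in>A. x i powr s) / c"
    by (simp add: S_def sum_divide_distrib)
  then have "((S / c) powr s) powr (1/s) \<le> ((\<Sum>i\<in>A. x i powr s) / c) powr (1/s)"
    using assms by (intro powr_mono2) auto
  then have "S / c \<le> (\<Sum>i\<in>A. x i powr s) powr (1/s) / c powr (1/s)"
    using S c assms by (simp add: powr_powr powr_divide sum_nonneg)
  then have "S \<le> c / c powr (1/s) * (\<Sum>i\<in>A. x i powr s) powr (1/s)"
    using c by (simp add: field_simps)
  also have "c / c powr (1/s) = c powr (1 - 1/s)"
    using c by (simp add: powr_diff)
  finally show ?thesis by (simp add: S_def c_def)
next
  case False
  then show ?thesis by auto
qed

lemma sum_le_lp_norm:
  assumes p: "p \<ge> 1" and x: "x \<in> lp_space p" "lp_norm p x \<le> \<delta>" and A: "finite A" "real (card A) \<le> n" "n \<ge> 1"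
  shows "(\<Sum>k\<in>A. \<bar>x k\<bar>) \<le> n powr (1 - enn2real (1/p)) * \<delta>"
proof (cases "p = \<infinity>")
  case True
  have "\<bar>x k\<bar> \<le> \<delta>" for k
  proof -
    have "\<bar>x k\<bar> \<le> (SUP k. \<bar>x k\<bar>)"
      using x(1) True by (intro cSUP_upper) (auto simp: lp_space_def)
    also have "\<dots> \<le> \<delta>" using x(2) True by (simp add: lp_norm_def)
    finally show ?thesis .
  qed
  note le = this
  then have d: "0 \<le> \<delta>" using order_trans[OF abs_ge_zero] by blast
  have "(\<Sum>k\<in>A. \<bar>x k\<bar>) \<le> real (card A) * \<delta>" by (intro sum_bounded_above le)
  also have "real (card A) * \<delta> \<le> n * \<delta>" using A d by (intro mult_right_mono) auto
  finally show ?thesis using True A by simp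
next
  case False
  define P where "P = enn2real p"
  have P: "P \<ge> 1" using p False by (cases p) (auto simp: P_def)
  have P1: "enn2real (1/p) = 1/P"
    using p False P by (cases p) (auto simp: P_def divide_ennreal simp flip: ennreal_1)
  have sm: "summable (\<lambda>k. \<bar>x k\<bar> powr P)" and
    nrm: "(\<Sum>k. \<bar>x k\<bar> powr P) powr (1/P) \<le> \<delta>"
    using x False by (simp_all add: lp_space_def lp_norm_def P_def)
  have "(\<Sum>k\<in>A. \<bar>x k\<bar>) \<le> real (card A) powr (1 - 1/P) * (\<Sum>k\<in>A. \<bar>x k\<bar> powr P) powr (1/P)"
    by (rule sum_le_card_powr_mult[OF P]) auto
  also have "\<dots> \<le> n powr (1 - 1/P) * (\<Sum>k. \<bar>x k\<bar> powr P) powr (1/P)"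
    using A P by (intro mult_mono powr_mono2 sum_le_suminf sm sum_nonneg) auto
  also have "\<dots> \<le> n powr (1 - 1/P) * \<delta>"
    using nrm by (intro mult_left_mono) auto
  finally show ?thesis by (simp add: P1)
qed

text \<open>
  The weight \<open>k powr (e - \<mu>)\<close> decreases in \<open>k\<close>, so on the block it is at most its value at \<open>n\<close>, and
  the power mean inequality over the \<open>n\<close> indices costs a factor \<open>n powr (1 - 1/s)\<close>. Compared with
  Hoelder's inequality on the whole tail, working block by block treats \<open>s = 1\<close> and \<open>s > 1\<close> alike.
\<close>
lemma weighted_dyadic_block_le:
  fixes x :: "nat \<Rightarrow> real"
  assumes s: "s \<ge> 1" and x: "\<And>k. 0 \<le> x k" and n: "n \<ge> 1"
    and W: "\<And>F. finite F \<Longrightarrow> 0 \<notin> F \<Longrightarrow> (\<Sum>k\<in>F. (real k powr \<mu> * x k) powr s) \<le> 1"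
    and \<rho>: "\<mu> - e - 1 + 1/s > 0"
  shows "(\<Sum>k\<in>{n<..2*n}. real k powr e * x k) \<le> real n powr (- (\<mu> - e - 1 + 1/s))"
proof -
  have "1/s \<le> 1" using s by simp
  with \<rho> have e: "e - \<mu> \<le> 0" by linarith
  have "(\<Sum>k\<in>{n<..2*n}. real k powr e * x k)
      \<le> (\<Sum>k\<in>{n<..2*n}. real n powr (e - \<mu>) * (real k powr \<mu> * x k))"
  proof (intro sum_mono)
    fix k assume k: "k \<in> {n<..2*n}"
    have "real k powr e * x k = real k powr (e - \<mu>) * (real k powr \<mu> * x k)"
      using k by (simp flip: powr_add mult.assoc)
    also have "\<dots> \<le> real n powr (e - \<mu>) * (real k powr \<mu> * x k)"
      using k n e x by (intro mult_right_mono powr_mono2') auto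
    finally show "real k powr e * x k \<le> real n powr (e - \<mu>) * (real k powr \<mu> * x k)" .
  qed
  also have "\<dots> = real n powr (e - \<mu>) * (\<Sum>k\<in>{n<..2*n}. real k powr \<mu> * x k)"
    by (simp add: sum_distrib_left)
  also have "\<dots> \<le> real n powr (e - \<mu>) * (real (card {n<..2*n}) powr (1 - 1/s)
      * (\<Sum>k\<in>{n<..2*n}. (real k powr \<mu> * x k) powr s) powr (1/s))"
    using x by (intro mult_left_mono sum_le_card_powr_mult[OF s]) auto
  also have "\<dots> \<le> real n powr (e - \<mu>) * (real (card {n<..2*n}) powr (1 - 1/s) * 1 powr (1/s))"
    using s by (intro mult_left_mono powr_mono2 W sum_nonneg) auto
  also have "\<dots> = real n powr (e - \<mu> + (1 - 1/s))" by (simp add: powr_add)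
  also have "e - \<mu> + (1 - 1/s) = - (\<mu> - e - 1 + 1/s)" by simp
  finally show ?thesis .
qed

text \<open>
  The bounds for the blocks form a geometric series with ratio \<open>2 powr (-\<rho>) < 1\<close>, where
  \<open>\<rho> = \<mu> - e - 1 + 1/s\<close>.
\<close>
lemma weighted_tail_le:
  fixes x :: "nat \<Rightarrow> real"
  assumes s: "s \<ge> 1" and x: "\<And>k. 0 \<le> x k" and n: "n \<ge> 1"
    and W: "\<And>F. finite F \<Longrightarrow> 0 \<notin> F \<Longrightarrow> (\<Sum>k\<in>F. (real k powr \<mu> * x k) powr s) \<le> 1"
    and \<rho>: "\<mu> - e - 1 + 1/s > 0"
  shows "(\<Sum>k\<in>{n<..m}. real k powr e * x k)
    \<le> 1 / (1 - 2 powr (- (\<mu> - e - 1 + 1/s))) * real n powr (- (\<mu> - e - 1 + 1/s))"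
proof -
  define \<sigma> where "\<sigma> = - (\<mu> - e - 1 + 1/s)"
  define z where "z = 2 powr \<sigma>"
  have "2 powr \<sigma> < 2 powr (0::real)" using \<rho> by (intro powr_less_mono) (auto simp: \<sigma>_def)
  then have z: "0 < z" "z < 1" by (simp_all add: z_def)
  have blocks: "(\<Sum>k\<in>{n<..2^J*n}. real k powr e * x k) \<le> real n powr \<sigma> * (\<Sum>j<J. z ^ j)" for J
  proof (induction J)
    case 0
    then show ?case by simp
  next
    case (Suc J)
    have split: "{n<..2*M} = {n<..M} \<union> {M<..2*M}" if "n \<le> M" for M
      using that by auto
    have "{n<..2^Suc J*n} = {n<..2^J*n} \<union> {2^J*n<..2*(2^J*n)}"
      using split[of "2^J*n"] by (simp add: mult.assoc)
    then have "(\<Sum>k\<in>{n<..2^Suc J*n}. real k powr e * x k)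
        = (\<Sum>k\<in>{n<..2^J*n}. real k powr e * x k) + (\<Sum>k\<in>{2^J*n<..2*(2^J*n)}. real k powr e * x k)"
      by (simp only:) (intro sum.union_disjoint, auto)
    also have "\<dots> \<le> real n powr \<sigma> * (\<Sum>j<J. z ^ j) + real (2^J*n) powr \<sigma>"
      using n unfolding \<sigma>_def
      by (intro add_mono Suc.IH[unfolded \<sigma>_def] weighted_dyadic_block_le[OF s x _ W \<rho>]) auto
    also have "real (2^J*n) powr \<sigma> = real n powr \<sigma> * z ^ J"
      by (simp add: powr_mult z_def powr_realpow[symmetric] powr_powr mult.commute)
    finally show ?case by (simp add: algebra_simps)
  qed
  have "m \<le> 2 ^ m * n"
    using less_exp[of m] n by (metis le_trans less_imp_le mult.right_neutral mult_le_mono2)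
  then have "(\<Sum>k\<in>{n<..m}. real k powr e * x k) \<le> (\<Sum>k\<in>{n<..2^m*n}. real k powr e * x k)"
    using x by (intro sum_mono2) auto
  also have "\<dots> \<le> real n powr \<sigma> * (\<Sum>j<m. z ^ j)" by (rule blocks)
  also have "\<dots> \<le> real n powr \<sigma> * (\<Sum>j. z ^ j)"
    using z by (intro mult_left_mono sum_le_suminf summable_geometric) auto
  also have "\<dots> = 1 / (1 - z) * real n powr \<sigma>"
    using z by (simp add: suminf_geometric)
  finally show ?thesis by (simp add: \<sigma>_def z_def)
qed

section \<open>The truncation error\<close>

lemma wiener_weighted_sum_le:
  assumes s: "s \<ge> 1" and f: "f \<in> wiener_class s \<mu>" "wiener_norm s \<mu> f \<le> 1"
    and F: "finite F" "0 \<notin> F"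
  shows "(\<Sum>k\<in>F. (real k powr \<mu> * \<bar>legendre_coeff f k\<bar>) powr s) \<le> 1"
proof -
  let ?w = "\<lambda>k. real (max 1 k) powr (s * \<mu>) * \<bar>legendre_coeff f k\<bar> powr s"
  have sm: "summable ?w" using f(1) by (simp add: wiener_class_def)
  have S0: "0 \<le> (\<Sum>k. ?w k)" using sm by (intro suminf_nonneg) auto
  have "(\<Sum>k\<in>F. (real k powr \<mu> * \<bar>legendre_coeff f k\<bar>) powr s) = (\<Sum>k\<in>F. ?w k)"
  proof (rule sum.cong[OF refl])
    fix k assume "k \<in> F"
    then have "max 1 k = k" using F by (cases k) auto
    then show "(real k powr \<mu> * \<bar>legendre_coeff f k\<bar>) powr s = ?w k"
      by (simp add: powr_mult powr_powr mult.commute)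
  qed
  also have "\<dots> \<le> (\<Sum>k. ?w k)" by (intro sum_le_suminf sm F) auto
  also have "\<dots> = ((\<Sum>k. ?w k) powr (1/s)) powr s"
    using s S0 by (simp add: powr_powr)
  also have "\<dots> \<le> 1 powr s"
    using s f(2) by (intro powr_mono2) (auto simp: wiener_norm_def)
  finally show ?thesis by simp
qed

lemma truncated_deriv_eq_sum:
  "truncated_deriv r n a t = (\<Sum>k<Suc n. a k * legendre_deriv r k t)"
  unfolding truncated_deriv_def
  by (intro sum.mono_neutral_left) (auto simp: legendre_deriv_eq_0)

text \<open>
  The exponent \<open>e\<close> is the growth of the derivatives in \<open>L_q\<close>, and \<open>\<rho>\<close> is the rate at which the tail of
  the series decays.
\<close>
context
  fixes r :: nat and s \<mu> e \<rho> :: real and q :: ennreal and f :: "real \<Rightarrow> real"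
  assumes r: "1 \<le> r" and s: "1 \<le> s" and q: "2 \<le> q"
    and e_def: "e = 2 * real r + 1/2 - enn2real (2 / q)"
    and \<rho>_def: "\<rho> = \<mu> - e - 1 + 1/s" and \<rho>: "\<rho> > 0"
    and f: "f \<in> wiener_class s \<mu>" "wiener_norm s \<mu> f \<le> 1"
begin

lemma wiener_coeff_tail_le:
  assumes "n \<ge> 1"
  shows "(\<Sum>k\<in>{n<..m}. \<bar>legendre_coeff f k\<bar> * (4 * real k powr e))
    \<le> 4 * (1 / (1 - 2 powr (- \<rho>))) * real n powr (- \<rho>)"
proof -
  have "(\<Sum>k\<in>{n<..m}. \<bar>legendre_coeff f k\<bar> * (4 * real k powr e))
      = 4 * (\<Sum>k\<in>{n<..m}. real k powr e * \<bar>legendre_coeff f k\<bar>)"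
    by (simp add: sum_distrib_left mult_ac)
  also have "\<dots> \<le> 4 * (1 / (1 - 2 powr (- \<rho>)) * real n powr (- \<rho>))"
    unfolding \<rho>_def
    by (intro mult_left_mono weighted_tail_le s assms wiener_weighted_sum_le f)
      (use \<rho> in \<open>auto simp: \<rho>_def\<close>)
  finally show ?thesis by simp
qed

lemma wiener_coeff_summable: "summable (\<lambda>k. \<bar>legendre_coeff f k\<bar> * (4 * real k powr e))"
  (is "summable ?b")
proof (rule summableI_nonneg_bounded)
  fix n
  have "(\<Sum>k<n. ?b k) \<le> (\<Sum>k\<in>{..1} \<union> {1<..n}. ?b k)"
    by (intro sum_mono2) auto
  also have "\<dots> = (\<Sum>k\<le>1. ?b k) + (\<Sum>k\<in>{1<..n}. ?b k)"
    by (intro sum.union_disjoint) auto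
  also have "\<dots> \<le> (\<Sum>k\<le>1. ?b k) + 4 * (1 / (1 - 2 powr (- \<rho>))) * real 1 powr (- \<rho>)"
    by (intro add_left_mono wiener_coeff_tail_le) simp
  finally show "(\<Sum>k<n. ?b k)
      \<le> (\<Sum>k\<le>1. ?b k) + 4 * (1 / (1 - 2 powr (- \<rho>))) * real 1 powr (- \<rho>)" .
qed simp

lemma series_deriv_exists: "\<exists>g. is_series_deriv q r f g"
proof -
  have q1: "1 \<le> q" using q by (rule order_trans[rotated]) simp
  define h where "h k t = legendre_coeff f k * legendre_deriv r k t" for k t
  define b where "b k = \<bar>legendre_coeff f k\<bar> * (4 * real k powr e)" for k
  define g where "g t = (\<Sum>k. h k t)" for t
  have b: "summable b" "\<And>k. 0 \<le> b k"
    unfolding b_def by (rule wiener_coeff_summable) simp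
  have h: "Lq_bounded q (b k) (h k)" for k
    unfolding b_def h_def e_def
    by (intro Lq_bounded_cmult Lq_bounded_legendre_deriv q r) simp
  have "g \<in> Lq_space q"
    using Lq_bounded_suminf[OF q1 h b(2,1)] suminf_nonneg[OF b]
    by (simp add: Lq_bounded_iff[OF q1] g_def[abs_def])
  moreover have "(\<lambda>n. Lq_norm q (\<lambda>t. g t - truncated_deriv r n (legendre_coeff f) t)) \<longlonglongrightarrow> 0"
  proof (rule tendsto_sandwich[OF always_eventually always_eventually tendsto_const])
    show "\<forall>n. 0 \<le> Lq_norm q (\<lambda>t. g t - truncated_deriv r n (legendre_coeff f) t)"
      by (simp add: Lq_norm_nonneg)
    show "\<forall>n. Lq_norm q (\<lambda>t. g t - truncated_deriv r n (legendre_coeff f) t) \<le> (\<Sum>k. b (k + Suc n))"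
    proof
      fix n
      have "summable (\<lambda>k. b (k + Suc n))" using b(1) by (simp only: summable_iff_shift)
      then have "0 \<le> (\<Sum>k. b (k + Suc n))" using b(2) by (intro suminf_nonneg) auto
      then show "Lq_norm q (\<lambda>t. g t - truncated_deriv r n (legendre_coeff f) t) \<le> (\<Sum>k. b (k + Suc n))"
        using Lq_bounded_suminf_remainder[OF q1 h b(2,1), of "Suc n"]
        unfolding truncated_deriv_eq_sum g_def h_def
        by (simp only: Lq_bounded_iff[OF q1])
    qed
    have "(\<lambda>n. suminf b - (\<Sum>k<Suc n. b k)) \<longlonglongrightarrow> suminf b - suminf b"
      by (intro tendsto_diff tendsto_const LIMSEQ_Suc[OF summable_LIMSEQ[OF b(1)]])
    then show "(\<lambda>n. \<Sum>k. b (k + Suc n)) \<longlonglongrightarrow> 0"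
      by (simp only: suminf_minus_initial_segment[OF b(1)] diff_self)
  qed
  ultimately show ?thesis unfolding is_series_deriv_def by blast
qed

text \<open>
  The sum \<open>g\<close> is known only as a limit, so the triangle inequality is used with a partial sum \<open>S n\<close>
  between \<open>g\<close> and the truncation. The distance from \<open>S n\<close> to the truncation splits at \<open>N\<close> into the
  noise and a piece of the tail, both bounded uniformly in \<open>n\<close>, and \<open>n\<close> tends to infinity.
\<close>
lemma truncation_error_le:
  assumes p: "1 \<le> p" and \<xi>: "(\<lambda>k. legendre_coeff f k - a k) \<in> lp_space p"
      "lp_norm p (\<lambda>k. legendre_coeff f k - a k) \<le> \<delta>"
    and N: "r \<le> N" and g: "is_series_deriv q r f g" and e: "0 \<le> e"
  shows "Lq_norm q (\<lambda>t. g t - truncated_deriv r N a t)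
     \<le> 4 * real N powr (e + 1 - enn2real (1 / p)) * \<delta>
       + 4 * (1 / (1 - 2 powr (- \<rho>))) * real N powr (- \<rho>)"
    (is "_ \<le> ?R")
proof -
  have q1: "1 \<le> q" using q by (rule order_trans[rotated]) simp
  define S where "S n t = truncated_deriv r n (legendre_coeff f) t" for n t
  define B where "B n = (\<Sum>k\<in>{r..N}. \<bar>legendre_coeff f k - a k\<bar> * (4 * real k powr e))
      + (\<Sum>k\<in>{N<..n}. \<bar>legendre_coeff f k\<bar> * (4 * real k powr e))" for n
  have gS: "Lq_bounded q (Lq_norm q (\<lambda>t. g t - S n t)) (\<lambda>t. g t - S n t)" for n
  proof -
    have "Lq_bounded q (Lq_norm q g) g"
      using g by (simp add: Lq_bounded_iff[OF q1 Lq_norm_nonneg] is_series_deriv_def)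
    moreover define C where
      "C = (\<Sum>k=r..n. \<bar>legendre_coeff f k\<bar> * (4 * real k powr (2 * real r + 1/2 - enn2real (2 / q))))"
    have "Lq_bounded q C (S n)"
      unfolding C_def S_def[abs_def] truncated_deriv_def
      by (rule Lq_bounded_legendre_deriv_sum[OF q r]) simp
    moreover have C: "0 \<le> C" unfolding C_def by (intro sum_nonneg) simp
    ultimately have "Lq_bounded q (Lq_norm q g + \<bar>-1\<bar> * C) (\<lambda>t. g t + (-1) * S n t)"
      by (intro Lq_bounded_add q1 Lq_bounded_cmult Lq_norm_nonneg) auto
    then have "Lq_bounded q (Lq_norm q g + C) (\<lambda>t. g t - S n t)" by simp
    then show ?thesis
      using C Lq_norm_nonneg[of q g]
      by (simp add: Lq_bounded_iff[OF q1] Lq_norm_nonneg)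
  qed
  have SD: "Lq_bounded q (B n) (\<lambda>t. S n t - truncated_deriv r N a t)" if "N \<le> n" for n
  proof -
    have "S n t - truncated_deriv r N a t
        = (\<Sum>k\<in>{r..N}. (legendre_coeff f k - a k) * legendre_deriv r k t)
          + (\<Sum>k\<in>{N<..n}. legendre_coeff f k * legendre_deriv r k t)" for t
    proof -
      have "{r..n} = {r..N} \<union> {N<..n}" using N that by auto
      then have "S n t = (\<Sum>k\<in>{r..N}. legendre_coeff f k * legendre_deriv r k t)
          + (\<Sum>k\<in>{N<..n}. legendre_coeff f k * legendre_deriv r k t)"
        unfolding S_def truncated_deriv_def by (simp only:) (intro sum.union_disjoint, auto)
      then show ?thesis
        by (simp add: truncated_deriv_def left_diff_distrib sum_subtractf)
    qed
    then show ?thesis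
      unfolding B_def e_def
      by (simp only:) (intro Lq_bounded_add q1 Lq_bounded_legendre_deriv_sum q r sum_nonneg, auto)
  qed
  have BR: "B n \<le> ?R" for n
  proof -
    have N1: "real N \<ge> 1" using N r by simp
    have "(\<Sum>k\<in>{r..N}. \<bar>legendre_coeff f k - a k\<bar> * (4 * real k powr e))
        \<le> (\<Sum>k\<in>{r..N}. \<bar>legendre_coeff f k - a k\<bar> * (4 * real N powr e))"
      using e by (intro sum_mono mult_left_mono powr_mono2) auto
    also have "\<dots> = 4 * real N powr e * (\<Sum>k\<in>{r..N}. \<bar>legendre_coeff f k - a k\<bar>)"
      by (simp add: sum_distrib_left mult_ac)
    also have "\<dots> \<le> 4 * real N powr e * (real N powr (1 - enn2real (1/p)) * \<delta>)"
      using r by (intro mult_left_mono sum_le_lp_norm[OF p \<xi> _ _ N1]) auto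
    also have "\<dots> = 4 * real N powr (e + (1 - enn2real (1/p))) * \<delta>"
      by (simp only: powr_add mult.assoc)
    finally have "(\<Sum>k\<in>{r..N}. \<bar>legendre_coeff f k - a k\<bar> * (4 * real k powr e))
        \<le> 4 * real N powr (e + 1 - enn2real (1/p)) * \<delta>" by (simp add: add_diff_eq)
    moreover have "(\<Sum>k\<in>{N<..n}. \<bar>legendre_coeff f k\<bar> * (4 * real k powr e))
        \<le> 4 * (1 / (1 - 2 powr (- \<rho>))) * real N powr (- \<rho>)"
      using N r by (intro wiener_coeff_tail_le) auto
    ultimately show ?thesis unfolding B_def by (rule add_mono)
  qed
  have "Lq_norm q (\<lambda>t. g t - truncated_deriv r N a t) \<le> Lq_norm q (\<lambda>t. g t - S n t) + ?R"
    if n: "N \<le> n" for n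
  proof -
    have B0: "0 \<le> B n" unfolding B_def by (intro add_nonneg_nonneg sum_nonneg) auto
    have "Lq_bounded q (Lq_norm q (\<lambda>t. g t - S n t) + B n)
        (\<lambda>t. (g t - S n t) + (S n t - truncated_deriv r N a t))"
      by (intro Lq_bounded_add q1 gS SD n B0 Lq_norm_nonneg)
    then have "Lq_norm q (\<lambda>t. g t - truncated_deriv r N a t) \<le> Lq_norm q (\<lambda>t. g t - S n t) + B n"
      using B0 by (simp add: Lq_bounded_iff[OF q1] Lq_norm_nonneg)
    with BR[of n] show ?thesis by linarith
  qed
  moreover have "(\<lambda>n. Lq_norm q (\<lambda>t. g t - S n t) + ?R) \<longlonglongrightarrow> 0 + ?R"
    using g by (intro tendsto_intros) (simp add: is_series_deriv_def S_def[abs_def])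
  ultimately show ?thesis
    by (intro LIMSEQ_le_const[where X = "\<lambda>n. Lq_norm q (\<lambda>t. g t - S n t) + ?R"]) auto
qed

end

theorem theorem4p3:
  fixes r :: nat and s \<mu> C1 C2 :: real and p q :: ennreal
  assumes "r \<ge> 1" and "s \<ge> 1" and "p \<ge> 1" and "q \<ge> 2"
    and "\<mu> > 2 * real r - 1 / s - enn2real (2 / q) + 3 / 2"
    and "C1 > 0" and "C2 > 0"
  shows "\<exists>c>0. \<forall>(\<delta>::real) (f :: real \<Rightarrow> real) (f\<delta> :: nat \<Rightarrow> real) (N::nat).
    0 < \<delta> \<longrightarrow> \<delta> < 1 \<longrightarrow>
    f \<in> wiener_class s \<mu> \<longrightarrow> wiener_norm s \<mu> f \<le> 1 \<longrightarrow>
    (\<lambda>k. legendre_coeff f k - f\<delta> k) \<in> lp_space p \<longrightarrow>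
    lp_norm p (\<lambda>k. legendre_coeff f k - f\<delta> k) \<le> \<delta> \<longrightarrow>
    N \<ge> r \<longrightarrow>
    C1 * \<delta> powr (- (1 / (\<mu> - enn2real (1 / p) + 1 / s))) \<le> real N \<longrightarrow>
    real N \<le> C2 * \<delta> powr (- (1 / (\<mu> - enn2real (1 / p) + 1 / s))) \<longrightarrow>
    (\<exists>g. is_series_deriv q r f g) \<and>
    (\<forall>g. is_series_deriv q r f g \<longrightarrow>
      Lq_norm q (\<lambda>t. g t - truncated_deriv r N f\<delta> t)
        \<le> c * \<delta> powr ((\<mu> - 2 * real r + 1 / s + enn2real (2 / q) - 3 / 2)
                      / (\<mu> - enn2real (1 / p) + 1 / s)))"
proof -
  define e where "e = 2 * real r + 1/2 - enn2real (2 / q)"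
  define \<rho> where "\<rho> = \<mu> - e - 1 + 1/s"
  define \<theta> where "\<theta> = \<mu> - enn2real (1 / p) + 1 / s"
  define \<alpha> where "\<alpha> = e + 1 - enn2real (1 / p)"
  define K where "K = 1 / (1 - 2 powr (- \<rho>))"
  have e: "0 < e" using enn2real_two_divide_le_1[OF assms(4)] assms(1) by (simp add: e_def)
  have \<rho>: "0 < \<rho>" using assms(5) by (simp add: \<rho>_def e_def)
  have \<alpha>: "0 < \<alpha>" using e enn2real_one_divide_bounds[OF assms(3)] by (simp add: \<alpha>_def)
  have \<theta>\<alpha>: "\<theta> = \<rho> + \<alpha>" by (simp add: \<theta>_def \<rho>_def \<alpha>_def)
  have \<theta>: "0 < \<theta>" using \<theta>\<alpha> \<rho> \<alpha> by simp
  have "2 powr (- \<rho>) < 2 powr (0::real)" using \<rho> by (intro powr_less_mono) auto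
  then have K: "0 < K" by (simp add: K_def)
  \<comment> \<open>The upper bound on \<open>N\<close> controls the noise and the lower bound controls the tail.\<close>
  define c where "c = 4 * C2 powr \<alpha> + 4 * K * C1 powr (- \<rho>)"
  have c: "0 < c" using K assms(6,7) by (simp add: c_def add_pos_pos)
  have rate: "(\<mu> - 2 * real r + 1 / s + enn2real (2 / q) - 3 / 2) / \<theta> = \<rho> / \<theta>"
    by (simp add: \<rho>_def e_def)
  have bound: "Lq_norm q (\<lambda>t. g t - truncated_deriv r N f\<delta> t) \<le> c * \<delta> powr (\<rho> / \<theta>)"
    if \<delta>: "0 < \<delta>" and f: "f \<in> wiener_class s \<mu>" "wiener_norm s \<mu> f \<le> 1"
      and \<xi>: "(\<lambda>k. legendre_coeff f k - f\<delta> k) \<in> lp_space p"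
        "lp_norm p (\<lambda>k. legendre_coeff f k - f\<delta> k) \<le> \<delta>"
      and N: "r \<le> N" "C1 * \<delta> powr (- (1 / \<theta>)) \<le> real N" "real N \<le> C2 * \<delta> powr (- (1 / \<theta>))"
      and g: "is_series_deriv q r f g"
    for \<delta> f f\<delta> N g
  proof -
    have "real N powr \<alpha> \<le> (C2 * \<delta> powr (- (1 / \<theta>))) powr \<alpha>"
      using N \<alpha> by (intro powr_mono2) auto
    also have "\<dots> = C2 powr \<alpha> * \<delta> powr (- (\<alpha> / \<theta>))"
      using assms(7) by (simp add: powr_mult powr_powr)
    finally have "real N powr \<alpha> * \<delta> \<le> C2 powr \<alpha> * \<delta> powr (- (\<alpha> / \<theta>)) * \<delta> powr 1"
      using \<delta> by (simp add: mult_right_mono)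
    also have "\<dots> = C2 powr \<alpha> * \<delta> powr (- (\<alpha> / \<theta>) + 1)"
      by (simp only: powr_add mult.assoc)
    also have "- (\<alpha> / \<theta>) + 1 = \<rho> / \<theta>"
      using \<theta> by (simp add: \<theta>\<alpha> field_simps)
    finally have data: "real N powr \<alpha> * \<delta> \<le> C2 powr \<alpha> * \<delta> powr (\<rho> / \<theta>)" .
    have "real N powr (- \<rho>) \<le> (C1 * \<delta> powr (- (1 / \<theta>))) powr (- \<rho>)"
      using N \<rho> assms(6) \<delta> by (intro powr_mono2') auto
    also have "\<dots> = C1 powr (- \<rho>) * \<delta> powr (\<rho> / \<theta>)"
      using assms(6) by (simp add: powr_mult powr_powr)
    finally have tail: "real N powr (- \<rho>) \<le> C1 powr (- \<rho>) * \<delta> powr (\<rho> / \<theta>)" .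
    have "Lq_norm q (\<lambda>t. g t - truncated_deriv r N f\<delta> t)
        \<le> 4 * real N powr \<alpha> * \<delta> + 4 * K * real N powr (- \<rho>)"
      unfolding \<alpha>_def K_def
      using truncation_error_le[OF assms(1,2,4) e_def \<rho>_def \<rho> f assms(3) \<xi> N(1) g] e by simp
    also have "\<dots> = 4 * (real N powr \<alpha> * \<delta>) + 4 * K * real N powr (- \<rho>)" by simp
    also have "\<dots> \<le> 4 * (C2 powr \<alpha> * \<delta> powr (\<rho> / \<theta>)) + 4 * K * (C1 powr (- \<rho>) * \<delta> powr (\<rho> / \<theta>))"
      using K by (intro add_mono mult_left_mono data tail) auto
    finally show ?thesis by (simp add: c_def algebra_simps)
  qed
  show ?thesis
    unfolding \<theta>_def[symmetric] rate
    using c bound series_deriv_exists[OF assms(1,2,4) e_def \<rho>_def \<rho>]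
    by (intro exI[of _ c]) blast
qed

end
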